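(* There exist a Borel vector field $v\colon\mathbb{R}^2\to\mathbb{R}^2$ with compact support such that $|v|$ is integrable with respect to Lebesgue measure (hence with respect to the standard Gaussian measure $\gamma$ on $\mathbb{R}^2$), and a continuous probability density $\varrho$ on $\mathbb{R}^2$ that is proportional to $\varrho_2$ outside of a ball, such that the measure $\mu=\varrho\,dx$ satisfies the equation $L_b^*\mu=0$ with $b(x)=-x+v(x)$, where $|x|,|v|\in L^1(\mu)$, but $\varrho$ does not belong to $W^{1,1}_{loc}(\mathbb{R}^2)$.
   Context: $\varrho_2(x)=(2\pi)^{-1}\exp(-|x|^2/2)$ is the density of the standard Gaussian measure $\gamma$ on $\mathbb{R}^2$. A probability density is a nonnegative measurable function with Lebesgue integral $1$. For a Borel vector field $b$ on $\mathbb{R}^d$ set $L_b\varphi=\Delta\varphi+\langle b,\nabla\varphi\rangle$. A bounded Borel measure $\mu$ on $\mathbb{R}^d$ satisfies $L_b^*\mu=0$, where $|b|$ is locally integrable with respect to $\mu$, if $\int_{\mathbb{R}^d}L_b\varphi\,d\mu=0$ for all smooth compactly supported functions $\varphi\in C_0^\infty(\mathbb{R}^d)$. $W^{1,1}_{loc}(\mathbb{R}^2)$ is the class of functions $f$ such that for every $\zeta\in C_0^\infty(\mathbb{R}^2)$ the function $\zeta f$ and its first-order generalized partial derivatives belong to $L^1(\mathbb{R}^2)$. *)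

theory Defs
  imports "HOL-Analysis.Analysis"
begin

definition partial :: "'a::euclidean_space \<Rightarrow> ('a \<Rightarrow> real) \<Rightarrow> 'a \<Rightarrow> real" where
  "partial i f x = frechet_derivative f (at x) i"

text \<open>Beyond first order, \<open>C\<^sup>k\<close> is defined through iterated partial derivatives. Requiring
  differentiability at each stage makes \<open>frechet_derivative\<close>, a choice operator, the actual
  derivative.\<close>

primrec Ck :: "nat \<Rightarrow> ('a::euclidean_space \<Rightarrow> real) \<Rightarrow> bool" where
  "Ck 0 f \<longleftrightarrow> continuous_on UNIV f"
| "Ck (Suc k) f \<longleftrightarrow> f differentiable_on UNIV \<and> (\<forall>i\<in>Basis. Ck k (partial i f))"

definition compact_support :: "('a::euclidean_space \<Rightarrow> 'b::zero) \<Rightarrow> bool" where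
  "compact_support f \<longleftrightarrow> compact (closure {x. f x \<noteq> 0})"

definition test_function :: "('a::euclidean_space \<Rightarrow> real) \<Rightarrow> bool" where
  "test_function \<phi> \<longleftrightarrow> (\<forall>k. Ck k \<phi>) \<and> compact_support \<phi>"

definition grad :: "('a::euclidean_space \<Rightarrow> real) \<Rightarrow> 'a \<Rightarrow> 'a" where
  "grad f x = (\<Sum>i\<in>Basis. partial i f x *\<^sub>R i)"

definition laplacian :: "('a::euclidean_space \<Rightarrow> real) \<Rightarrow> 'a \<Rightarrow> real" where
  "laplacian f x = (\<Sum>i\<in>Basis. partial i (partial i f) x)"

definition drift_operator ::
  "('a::euclidean_space \<Rightarrow> 'a) \<Rightarrow> ('a \<Rightarrow> real) \<Rightarrow> 'a \<Rightarrow> real" where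
  "drift_operator b \<phi> x = laplacian \<phi> x + b x \<bullet> grad \<phi> x"

text \<open>The equation \<open>L\<^sub>b\<^sup>*\<mu> = 0\<close>. Local integrability of \<open>\<bar>b\<bar>\<close> is part of the
  definition: it makes every integrand below integrable, so that the value \<open>0\<close> which the
  Bochner integral assigns to non-integrable functions plays no role.\<close>

definition stationary_FPK ::
  "('a::euclidean_space \<Rightarrow> 'a) \<Rightarrow> 'a measure \<Rightarrow> bool" where
  "stationary_FPK b \<mu> \<longleftrightarrow>
     sets \<mu> = sets borel \<and> finite_measure \<mu> \<and> b \<in> borel_measurable borel \<and>
     (\<forall>K. compact K \<longrightarrow> set_integrable \<mu> K (\<lambda>x. norm (b x))) \<and>
     (\<forall>\<phi>. test_function \<phi> \<longrightarrow> (\<integral>x. drift_operator b \<phi> x \<partial>\<mu>) = 0)"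

definition gauss_density2 :: "real^2 \<Rightarrow> real" where
  "gauss_density2 x = inverse (2 * pi) * exp (- (norm x)\<^sup>2 / 2)"

definition gauss_measure2 :: "(real^2) measure" where
  "gauss_measure2 = density lborel (\<lambda>x. ennreal (gauss_density2 x))"

definition probability_density :: "('a::euclidean_space \<Rightarrow> real) \<Rightarrow> bool" where
  "probability_density \<rho> \<longleftrightarrow> (\<forall>x. 0 \<le> \<rho> x) \<and> has_bochner_integral lborel \<rho> 1"

text \<open>Generalized (distributional) derivatives; \<open>f\<close> and \<open>g\<close> are meant to be locally
  integrable, which \<open>W11_loc\<close> ensures where it uses this notion.\<close>

definition weak_partial ::
  "'a::euclidean_space \<Rightarrow> ('a \<Rightarrow> real) \<Rightarrow> ('a \<Rightarrow> real) \<Rightarrow> bool" where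
  "weak_partial i f g \<longleftrightarrow>
     (\<forall>\<phi>. test_function \<phi> \<longrightarrow>
        (\<integral>x. f x * partial i \<phi> x \<partial>lebesgue) = - (\<integral>x. g x * \<phi> x \<partial>lebesgue))"

definition W11_loc :: "('a::euclidean_space \<Rightarrow> real) \<Rightarrow> bool" where
  "W11_loc f \<longleftrightarrow>
     (\<forall>\<zeta>. test_function \<zeta> \<longrightarrow>
        integrable lebesgue (\<lambda>x. \<zeta> x * f x) \<and>
        (\<forall>i\<in>Basis. \<exists>g. integrable lebesgue g \<and> weak_partial i (\<lambda>x. \<zeta> x * f x) g))"

end

theory Submission
  imports Defs "HOL-Computational_Algebra.Polynomial" "HOL-Probability.Sinc_Integral"
begin

text \<open>
  With \<open>\<rho> = c (\<rho>\<^sub>2 + W)\<close> and \<open>v = (F e\<^sub>1 + W x) / (\<rho>\<^sub>2 + W)\<close>, the terms \<open>W x\<close> of the drift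
  cancel and \<open>L\<^sub>b\<^sup>*\<mu> = 0\<close> reduces to \<open>\<Delta>W = \<partial>\<^sub>1 F\<close> in the sense of distributions. So a continuous
  \<open>W\<close> and an integrable \<open>F\<close>, both supported in a square, are needed such that \<open>\<nabla>W\<close> is not integrable;
  they exist because \<open>F \<mapsto> \<partial>\<^sub>2 \<Delta>\<^sup>-\<^sup>1 \<partial>\<^sub>1 F\<close> is unbounded on \<open>L\<^sup>1\<close>.

  The building block is the regularised dipole \<open>w = x\<^sub>1 (1 - s)\<^sub>+\<^sup>3 / (s + \<delta>)\<close>, \<open>s = \<bar>x\<bar>\<^sup>2\<close>: its right-hand
  side is bounded in \<open>L\<^sup>1\<close> uniformly in \<open>\<delta>\<close>, while \<open>\<partial>\<^sub>2 w\<close> is of size \<open>1 / s\<close> on each of the about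
  \<open>log (1 / \<delta>)\<close> dyadic scales above \<open>\<delta>\<close>. Tiling the square by \<open>N\<^sup>2\<close> copies \<open>w (N x - p) / N\<close> preserves both
  \<open>L\<^sup>1\<close> quantities and divides the supremum of \<open>w\<close> by \<open>N\<close>. Finally, packets with increasing
  gradients are summed over a sequence of disjoint squares.
\<close>

section \<open>Smooth functions and test functions\<close>

text \<open>Without cutoff and with \<open>\<delta> = 0\<close>, \<open>w\<close> is
  \<open>x\<^sub>1 / |x|\<^sup>2\<close>, the first derivative of \<open>log |x|\<close>, so its
  Laplacian is \<open>\<partial>\<^sub>1\<close> of a multiple of the Dirac mass. Hence the
  right-hand side of the regularised dipole is an approximate identity plus a bounded term, whereas
  \<open>\<partial>\<^sub>2 w\<close> resembles a kernel homogeneous of degree -2, whose integral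
  diverges logarithmically in the plane. Regularising makes \<open>w\<close> continuous, but its
  supremum grows as \<open>\<delta>\<close> shrinks and would destroy positivity of
  \<open>\<rho>\<^sub>2 + W\<close>, the denominator of \<open>v\<close>; hence the tiling. Failure
  of \<open>W11_loc\<close> is proved by duality: an integrable weak derivative \<open>g\<close>
  would bound all pairings of the density with \<open>\<partial>\<^sub>2 \<eta>\<close>, where
  \<open>|\<eta>| \<le> 1\<close>, by the integral of \<open>|g|\<close>. Each packet therefore
  carries its own \<open>\<eta>\<close> as a witness, and only pairings have to be tracked.
  Shrinking a packet divides its pairing and the L1 norm of \<open>f\<close> by the same factor; as
  the bound on that norm does not depend on the size of the pairing, the loss is compensated in
  advance.\<close>

lemma partial_eq: "(f has_derivative f') (at x) \<Longrightarrow> partial i f x = f' i"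
  by (simp add: partial_def frechet_derivative_at[symmetric])

lemma Ck_differentiable: "Ck (Suc k) f \<Longrightarrow> f differentiable (at x)"
  by (simp add: differentiable_on_def)

lemma Ck_has_derivative: "Ck (Suc k) f \<Longrightarrow> (f has_derivative frechet_derivative f (at x)) (at x)"
  using Ck_differentiable frechet_derivative_works by blast

lemma Ck_partial: "Ck (Suc k) f \<Longrightarrow> i \<in> Basis \<Longrightarrow> Ck k (partial i f)"
  by simp

lemma Ck_SucD: "Ck (Suc k) f \<Longrightarrow> Ck k f"
proof (induction k arbitrary: f)
  case 0
  then show ?case by (simp add: differentiable_imp_continuous_on)
next
  case (Suc k)
  then show ?case by (metis Ck.simps(2))
qed

lemma Ck_continuous: "Ck k f \<Longrightarrow> continuous_on S f"
  by (induction k arbitrary: f)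
    (auto intro: continuous_on_subset differentiable_imp_continuous_on)

text \<open>Exhibiting a derivative identifies the choice operator in \<open>partial\<close>, so the
  closure properties below can use the usual rules of differentiation.\<close>

lemma Ck_SucI:
  assumes "\<And>x. (f has_derivative f' x) (at x)" "\<And>i. i \<in> Basis \<Longrightarrow> Ck k (\<lambda>x. f' x i)"
  shows "Ck (Suc k) f"
proof -
  have "partial i f = (\<lambda>x. f' x i)" for i
    using assms(1) by (simp add: fun_eq_iff partial_eq)
  then show ?thesis
    using assms by (auto simp: differentiable_on_def differentiable_def)
qed

lemma Ck_const: "Ck k (\<lambda>_. c)"
proof (induction k arbitrary: c)
  case (Suc k)
  show ?case by (rule Ck_SucI[where f' = "\<lambda>_ _. 0"]) (auto simp: Suc)
qed simp

lemma Ck_add: "Ck k f \<Longrightarrow> Ck k g \<Longrightarrow> Ck k (\<lambda>x. f x + g x)"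
proof (induction k arbitrary: f g)
  case 0
  then show ?case by (simp add: continuous_on_add)
next
  case (Suc k)
  show ?case
  proof (rule Ck_SucI)
    show "((\<lambda>x. f x + g x) has_derivative
        (\<lambda>h. frechet_derivative f (at x) h + frechet_derivative g (at x) h)) (at x)" for x
      using Suc.prems Ck_has_derivative by (auto intro!: has_derivative_add)
    show "Ck k (\<lambda>x. frechet_derivative f (at x) i + frechet_derivative g (at x) i)"
      if "i \<in> Basis" for i
      using Suc.IH[OF Ck_partial[OF Suc.prems(1) that] Ck_partial[OF Suc.prems(2) that]]
      by (simp add: partial_def)
  qed
qed

lemma Ck_mult: "Ck k f \<Longrightarrow> Ck k g \<Longrightarrow> Ck k (\<lambda>x. f x * g x)"
proof (induction k arbitrary: f g)
  case 0
  then show ?case by (simp add: continuous_on_mult)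
next
  case (Suc k)
  show ?case
  proof (rule Ck_SucI)
    show "((\<lambda>x. f x * g x) has_derivative
        (\<lambda>h. f x * frechet_derivative g (at x) h + frechet_derivative f (at x) h * g x)) (at x)" for x
      using Suc.prems Ck_has_derivative by (auto intro!: has_derivative_mult)
    show "Ck k (\<lambda>x. f x * frechet_derivative g (at x) i + frechet_derivative f (at x) i * g x)"
      if "i \<in> Basis" for i
      using Ck_add[OF Suc.IH[OF Ck_SucD[OF Suc.prems(1)] Ck_partial[OF Suc.prems(2) that]]
          Suc.IH[OF Ck_partial[OF Suc.prems(1) that] Ck_SucD[OF Suc.prems(2)]]]
      by (simp add: partial_def)
  qed
qed

lemma Ck_sum: "(\<And>i. i \<in> I \<Longrightarrow> Ck k (f i)) \<Longrightarrow> Ck k (\<lambda>x. \<Sum>i\<in>I. f i x)"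
  by (induction I rule: infinite_finite_induct) (auto intro: Ck_const Ck_add)

lemma Ck_inverse:
  assumes "\<And>x. f x \<noteq> 0"
  shows "Ck k f \<Longrightarrow> Ck k (\<lambda>x. inverse (f x))"
proof (induction k)
  case 0
  then show ?case using assms by (simp add: continuous_on_inverse)
next
  case (Suc k)
  let ?g = "\<lambda>x. inverse (f x)"
  have IH: "Ck k ?g" using Suc Ck_SucD by blast
  show ?case
  proof (rule Ck_SucI)
    show "(?g has_derivative (\<lambda>h. - (?g x * frechet_derivative f (at x) h * ?g x))) (at x)" for x
      by (rule Deriv.has_derivative_inverse[OF assms Ck_has_derivative[OF Suc.prems]])
    show "Ck k (\<lambda>x. - (?g x * frechet_derivative f (at x) i * ?g x))" if "i \<in> Basis" for i
      using Ck_mult[OF Ck_const[of _ "-1"] Ck_mult[OF Ck_mult[OF IH Ck_partial[OF Suc.prems that]] IH]]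
      by (simp add: partial_def)
  qed
qed

lemma Ck_affine:
  fixes f :: "'a::euclidean_space \<Rightarrow> real"
  shows "Ck k f \<Longrightarrow> Ck k (\<lambda>x. f (c *\<^sub>R x - a))"
proof (induction k arbitrary: f)
  case 0
  then have "continuous_on UNIV (f \<circ> (\<lambda>x. c *\<^sub>R x - a))"
    by (intro continuous_on_compose continuous_intros) (auto intro: continuous_on_subset)
  then show ?case by (simp add: o_def)
next
  case (Suc k)
  show ?case
  proof (rule Ck_SucI)
    have "((\<lambda>x. c *\<^sub>R x - a) has_derivative (\<lambda>h. c *\<^sub>R h)) (at x)" for x :: 'a
      by (auto intro!: derivative_eq_intros)
    from has_derivative_compose[OF this Ck_has_derivative[OF Suc.prems]]
    show "((\<lambda>x. f (c *\<^sub>R x - a)) has_derivative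
        (\<lambda>h. frechet_derivative f (at (c *\<^sub>R x - a)) (c *\<^sub>R h))) (at x)" for x
      by simp
    have "frechet_derivative f (at x) (c *\<^sub>R i) = c * frechet_derivative f (at x) i" for x i
      using linear_scale[OF has_derivative_linear[OF Ck_has_derivative[OF Suc.prems]], of x c i] by simp
    then show "Ck k (\<lambda>x. frechet_derivative f (at (c *\<^sub>R x - a)) (c *\<^sub>R i))"
      if "i \<in> Basis" for i
      using Ck_mult[OF Ck_const Suc.IH[OF Ck_partial[OF Suc.prems that]]]
      by (simp add: partial_def)
  qed
qed

lemma partial_affine:
  fixes f :: "'a::euclidean_space \<Rightarrow> real"
  assumes "f differentiable (at (c *\<^sub>R x - a))"
  shows "partial i (\<lambda>x. f (c *\<^sub>R x - a)) x = c * partial i f (c *\<^sub>R x - a)"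
proof -
  let ?D = "frechet_derivative f (at (c *\<^sub>R x - a))"
  have D: "(f has_derivative ?D) (at (c *\<^sub>R x - a))"
    using assms frechet_derivative_works by blast
  have "((\<lambda>x. c *\<^sub>R x - a) has_derivative (\<lambda>h. c *\<^sub>R h)) (at x)"
    by (auto intro!: derivative_eq_intros)
  from partial_eq[OF has_derivative_compose[OF this D]]
  show ?thesis
    using linear_scale[OF has_derivative_linear[OF D]] by (simp add: partial_def)
qed

lemma Ck_real_comp_inner:
  fixes f :: "real \<Rightarrow> real" and v :: "'a::euclidean_space"
  shows "Ck k f \<Longrightarrow> Ck k (\<lambda>x. f (a + c * (x \<bullet> v)))"
proof (induction k arbitrary: f)
  case 0
  then have "continuous_on UNIV (f \<circ> (\<lambda>x. a + c * (x \<bullet> v)))"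
    by (intro continuous_on_compose continuous_intros) (auto intro: continuous_on_subset)
  then show ?case by (simp add: o_def)
next
  case (Suc k)
  show ?case
  proof (rule Ck_SucI)
    have "((\<lambda>x. a + c * (x \<bullet> v)) has_derivative (\<lambda>h. c * (h \<bullet> v))) (at x)" for x :: 'a
      by (auto intro!: derivative_eq_intros)
    from has_derivative_compose[OF this Ck_has_derivative[OF Suc.prems]]
    show "((\<lambda>x. f (a + c * (x \<bullet> v))) has_derivative
        (\<lambda>h. frechet_derivative f (at (a + c * (x \<bullet> v))) (c * (h \<bullet> v)))) (at x)" for x
      by simp
    have "frechet_derivative f (at (a + c * (x \<bullet> v))) (c * (i \<bullet> v)) =
        c * (i \<bullet> v) * partial 1 f (a + c * (x \<bullet> v))" for x i
      using linear_scale[OF has_derivative_linear[OF Ck_has_derivative[OF Suc.prems]], of _ "c * (i \<bullet> v)" 1]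
      by (simp add: partial_def)
    moreover have "Ck k (partial 1 f)"
      using Ck_partial[OF Suc.prems] by simp
    ultimately show "Ck k (\<lambda>x. frechet_derivative f (at (a + c * (x \<bullet> v))) (c * (i \<bullet> v)))" for i
      by (simp only: Ck_mult[OF Ck_const Suc.IH])
  qed
qed

section \<open>A smooth cutoff on the real line\<close>

definition flat_exp :: "real poly \<Rightarrow> real \<Rightarrow> real" where
  "flat_exp P t = (if t > 0 then poly P (1 / t) * exp (- (1 / t)) else 0)"

text \<open>The extra power of \<open>u\<close> is what the induction on coefficients needs:
  splitting off the constant coefficient leaves the remaining polynomial with one more factor
  \<open>u\<close>.\<close>

lemma poly_times_exp_minus_tendsto_0:
  "((\<lambda>u::real. u ^ k * poly P u * exp (- u)) \<longlongrightarrow> 0) at_top"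
proof (induction P arbitrary: k)
  case 0
  then show ?case by simp
next
  case (pCons a P)
  have "((\<lambda>u::real. a * (u ^ k / exp u)) \<longlongrightarrow> a * 0) at_top"
    by (intro tendsto_intros tendsto_power_div_exp_0)
  from tendsto_add[OF this pCons(2)[of "Suc k"]] show ?case
    by (simp add: algebra_simps exp_minus divide_inverse)
qed

text \<open>With \<open>u = 1 / t\<close> the derivative is
  \<open>u\<^sup>2 (P - P') exp (- u)\<close>: the family is closed under differentiation, so
  smoothness follows by induction with \<open>P\<close> arbitrary. At 0 the right difference
  quotient is \<open>u P(u) exp (- u)\<close>, which tends to 0.\<close>

lemma flat_exp_DERIV:
  "(flat_exp P has_real_derivative flat_exp ([:0, 0, 1:] * (P - pderiv P)) t) (at t)"
proof -
  consider "t > 0" | "t < 0" | "t = 0" by linarith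
  then show ?thesis
  proof cases
    case 1
    have "((\<lambda>t. poly P (1 / t) * exp (- (1 / t))) has_real_derivative
        flat_exp ([:0, 0, 1:] * (P - pderiv P)) t) (at t)"
    proof -
      have 2: "((\<lambda>t. 1 / t) has_real_derivative - (1 / t\<^sup>2)) (at t)"
        using 1 by (auto intro!: derivative_eq_intros simp: power2_eq_square)
      have "((\<lambda>t. exp (- (1 / t))) has_real_derivative exp (- (1 / t)) * - (- (1 / t\<^sup>2))) (at t)"
        using DERIV_chain2[OF DERIV_exp DERIV_minus[OF 2]] .
      from DERIV_mult[OF DERIV_chain2[OF poly_DERIV 2] this]
      show ?thesis
        by (rule DERIV_cong) (use 1 in \<open>simp add: flat_exp_def algebra_simps power2_eq_square\<close>)
    qed
    then show ?thesis
      by (rule has_field_derivative_transform_within_open[where S = "{0<..}"])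
        (use 1 in \<open>auto simp: flat_exp_def\<close>)
  next
    case 2
    have "((\<lambda>t. 0) has_real_derivative flat_exp ([:0, 0, 1:] * (P - pderiv P)) t) (at t)"
      using 2 by (simp add: flat_exp_def)
    then show ?thesis
      by (rule has_field_derivative_transform_within_open[where S = "{..<0}"])
        (use 2 in \<open>auto simp: flat_exp_def\<close>)
  next
    case 3
    have "((\<lambda>h. flat_exp P h / h) \<longlongrightarrow> 0) (at_right 0)"
    proof (rule Lim_transform_eventually)
      show "((\<lambda>h::real. (inverse h) ^ 1 * poly P (inverse h) * exp (- inverse h)) \<longlongrightarrow> 0) (at_right 0)"
        by (rule filterlim_compose[OF poly_times_exp_minus_tendsto_0 filterlim_inverse_at_top_right])
      show "\<forall>\<^sub>F h in at_right 0. (inverse h) ^ 1 * poly P (inverse h) * exp (- inverse h) = flat_exp P h / h"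
        by (auto simp: eventually_at_filter flat_exp_def field_simps)
    qed
    moreover have "((\<lambda>h. flat_exp P h / h) \<longlongrightarrow> 0) (at_left 0)"
      by (rule Lim_transform_eventually[OF tendsto_const])
        (auto simp: eventually_at_filter flat_exp_def)
    ultimately show ?thesis
      using 3 by (simp add: DERIV_def filterlim_at_split) (simp add: flat_exp_def)
  qed
qed

lemma Ck_real_SucI:
  fixes f :: "real \<Rightarrow> real"
  assumes "\<And>x. (f has_real_derivative f' x) (at x)" "Ck k f'"
  shows "Ck (Suc k) f"
  by (rule Ck_SucI[where f' = "\<lambda>x h. f' x * h"])
    (use assms in \<open>auto simp: has_field_derivative_def\<close>)

lemma Ck_flat_exp: "Ck k (flat_exp P)"
proof (induction k arbitrary: P)
  case 0
  have "isCont (flat_exp P) t" for t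
    by (rule DERIV_isCont[OF flat_exp_DERIV])
  then show ?case by (simp add: continuous_at_imp_continuous_on)
next
  case (Suc k)
  then show ?case by (intro Ck_real_SucI[OF flat_exp_DERIV])
qed

definition smooth_step :: "real \<Rightarrow> real" where
  "smooth_step t = flat_exp 1 t * inverse (flat_exp 1 t + flat_exp 1 (1 - t))"

lemma flat_exp_1_nonneg: "0 \<le> flat_exp 1 t" and flat_exp_1_pos: "t > 0 \<Longrightarrow> 0 < flat_exp 1 t"
  by (auto simp: flat_exp_def)

text \<open>At least one of \<open>t\<close> and \<open>1 - t\<close> is positive, so the
  denominator of \<open>smooth_step\<close> never vanishes.\<close>

lemma flat_exp_1_sum_pos: "0 < flat_exp 1 t + flat_exp 1 (1 - t)"
proof (cases "t > 0")
  case False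
  then have "0 < flat_exp 1 (1 - t)" by (intro flat_exp_1_pos) simp
  then show ?thesis using flat_exp_1_nonneg[of t] by linarith
qed (simp add: add_pos_nonneg flat_exp_1_nonneg flat_exp_1_pos)

lemma Ck_smooth_step: "Ck k smooth_step"
proof -
  have "Ck k (\<lambda>t. flat_exp 1 (1 + (- 1) * (t \<bullet> (1::real))))"
    by (intro Ck_real_comp_inner Ck_flat_exp)
  then have "Ck k (\<lambda>t. flat_exp 1 t * inverse (flat_exp 1 t + flat_exp 1 (1 - t)))"
    using flat_exp_1_sum_pos[THEN less_imp_neq, THEN not_sym]
    by (intro Ck_mult Ck_inverse Ck_add Ck_flat_exp) auto
  then show ?thesis by (simp add: smooth_step_def[abs_def])
qed

lemma smooth_step_bounds: "0 \<le> smooth_step t" "smooth_step t \<le> 1"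
  using flat_exp_1_nonneg[of t] flat_exp_1_nonneg[of "1 - t"] flat_exp_1_sum_pos[of t]
  by (auto simp: smooth_step_def field_simps)

lemma smooth_step_eq: "t \<le> 0 \<Longrightarrow> smooth_step t = 0" "1 \<le> t \<Longrightarrow> smooth_step t = 1"
  using flat_exp_1_sum_pos[of t] by (auto simp: smooth_step_def flat_exp_def)

definition plateau :: "real \<Rightarrow> real" where
  "plateau t = smooth_step (2 + t) * smooth_step (2 - t)"

lemma Ck_plateau: "Ck k plateau"
proof -
  have "Ck k (\<lambda>t. smooth_step (2 + 1 * (t \<bullet> (1::real))) * smooth_step (2 + (- 1) * (t \<bullet> 1)))"
    by (intro Ck_mult Ck_real_comp_inner Ck_smooth_step)
  then show ?thesis by (simp add: plateau_def[abs_def])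
qed

lemma plateau_bounds: "0 \<le> plateau t" "plateau t \<le> 1"
  by (auto simp: plateau_def smooth_step_bounds mult_le_one)

lemma plateau_eq_1: "\<bar>t\<bar> \<le> 1 \<Longrightarrow> plateau t = 1"
  by (simp add: plateau_def smooth_step_eq)

lemma plateau_eq_0: "\<bar>t\<bar> \<ge> 2 \<Longrightarrow> plateau t = 0"
  by (auto simp: plateau_def smooth_step_eq abs_if split: if_splits)

section \<open>Stability of test functions under sums, affine maps and derivatives\<close>

lemma compact_support_iff_bounded: "compact_support f \<longleftrightarrow> bounded {x. f x \<noteq> 0}"
  unfolding compact_support_def compact_eq_bounded_closed
  by (metis bounded_closure bounded_subset closed_closure closure_subset)

lemma test_function_sum:
  assumes "finite I" "\<And>i. i \<in> I \<Longrightarrow> test_function (f i)"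
  shows "test_function (\<lambda>x. \<Sum>i\<in>I. f i x)"
proof -
  have "bounded (\<Union>i\<in>I. {x. f i x \<noteq> 0})"
    using assms by (auto simp: test_function_def compact_support_iff_bounded)
  moreover have "{x. (\<Sum>i\<in>I. f i x) \<noteq> 0} \<subseteq> (\<Union>i\<in>I. {x. f i x \<noteq> 0})"
    using sum.neutral by fastforce
  ultimately show ?thesis
    using assms(2) unfolding test_function_def compact_support_iff_bounded
    by (auto intro: Ck_sum bounded_subset)
qed

lemma test_function_affine:
  fixes f :: "'a::euclidean_space \<Rightarrow> real"
  assumes "test_function f" "c \<noteq> 0"
  shows "test_function (\<lambda>x. f (c *\<^sub>R x - a))"
proof -
  have "bounded {x. f x \<noteq> 0}"
    using assms(1) by (simp add: test_function_def compact_support_iff_bounded)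
  then have "bounded ((\<lambda>x. (1 / c) *\<^sub>R (a + x)) ` {x. f x \<noteq> 0})"
    using bounded_scaling[OF bounded_translation, of _ "1/c" a] by (simp add: image_image)
  moreover have "{x. f (c *\<^sub>R x - a) \<noteq> 0} \<subseteq> (\<lambda>x. (1 / c) *\<^sub>R (a + x)) ` {x. f x \<noteq> 0}"
  proof
    fix x assume "x \<in> {x. f (c *\<^sub>R x - a) \<noteq> 0}"
    moreover have "x = (1 / c) *\<^sub>R (a + (c *\<^sub>R x - a))" using assms(2) by simp
    ultimately show "x \<in> (\<lambda>x. (1 / c) *\<^sub>R (a + x)) ` {x. f x \<noteq> 0}" by blast
  qed
  ultimately show ?thesis
    using assms(1) unfolding test_function_def compact_support_iff_bounded
    by (auto intro: Ck_affine bounded_subset)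
qed

lemma test_function_has_derivative:
  "test_function f \<Longrightarrow> (f has_derivative frechet_derivative f (at x)) (at x)"
  using Ck_has_derivative unfolding test_function_def by blast

lemma Ck_partial_test: "test_function f \<Longrightarrow> i \<in> Basis \<Longrightarrow> Ck k (partial i f)"
  using Ck_partial unfolding test_function_def by blast

text \<open>Openness of \<open>S\<close> transfers vanishing of the function to its derivative; this
  later removes all cross terms between disjoint packets.\<close>

lemma partial_eq_0_if_zero_on_open:
  assumes "open S" "x \<in> S" "\<And>y. y \<in> S \<Longrightarrow> f y = 0"
  shows "partial i f x = 0"
proof -
  have "((\<lambda>x. 0) has_derivative (\<lambda>_. 0)) (at x)" by simp
  then have "(f has_derivative (\<lambda>_. 0)) (at x)"
    by (rule has_derivative_transform_within_open[OF _ assms(1,2)]) (simp add: assms(3))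
  then show ?thesis by (rule partial_eq)
qed

lemma test_function_partial:
  assumes "test_function f" "i \<in> Basis"
  shows "test_function (partial i f)"
proof -
  have "bounded {x. f x \<noteq> 0}"
    using assms by (simp add: test_function_def compact_support_iff_bounded)
  moreover have "{x. partial i f x \<noteq> 0} \<subseteq> closure {x. f x \<noteq> 0}"
  proof (rule ccontr)
    assume "\<not> ?thesis"
    then obtain x where x: "partial i f x \<noteq> 0" "x \<in> - closure {x. f x \<noteq> 0}" by auto
    have "partial i f x = 0"
      by (rule partial_eq_0_if_zero_on_open[OF _ x(2)])
        (auto, use closure_subset[of "{x. f x \<noteq> 0}"] in blast)
    with x show False by simp
  qed
  ultimately show ?thesis
    using Ck_partial_test[OF assms] bounded_subset bounded_closure
    unfolding test_function_def compact_support_iff_bounded by blast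
qed

section \<open>Integrals over Euclidean space\<close>

lemma has_bochner_integral_lborel_affine:
  fixes f :: "'a::euclidean_space \<Rightarrow> real"
  assumes f: "integrable lborel f" and c: "c \<noteq> 0"
  shows "has_bochner_integral lborel (\<lambda>x. f (c *\<^sub>R x - a)) (integral\<^sup>L lborel f / \<bar>c\<bar> ^ DIM('a))"
proof -
  have [measurable]: "f \<in> borel_measurable borel"
    using f by auto
  let ?T = "\<lambda>x::'a. - a + c *\<^sub>R x"
  have "has_bochner_integral (density (distr lborel borel ?T) (\<lambda>_. ennreal (\<bar>c\<bar> ^ DIM('a)))) f
      (integral\<^sup>L lborel f)"
    using has_bochner_integral_integrable[OF f] lborel_affine[OF c, of "- a"]
    by (simp add: ennreal_power)
  then have "has_bochner_integral (distr lborel borel ?T) (\<lambda>x. \<bar>c\<bar> ^ DIM('a) *\<^sub>R f x)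
      (integral\<^sup>L lborel f)"
    by (simp add: has_bochner_integral_iff integrable_density integral_density)
  then have "has_bochner_integral lborel (\<lambda>x. \<bar>c\<bar> ^ DIM('a) *\<^sub>R f (?T x)) (integral\<^sup>L lborel f)"
    by (simp add: has_bochner_integral_iff integrable_distr_eq integral_distr)
  then have "has_bochner_integral lborel (\<lambda>x. 1 / \<bar>c\<bar> ^ DIM('a) * (\<bar>c\<bar> ^ DIM('a) *\<^sub>R f (?T x)))
      (1 / \<bar>c\<bar> ^ DIM('a) * integral\<^sup>L lborel f)"
    by (intro has_bochner_integral_mult_right)
  then show ?thesis using c by simp
qed

lemmas integrable_lborel_affine = has_bochner_integral_lborel_affine[THEN integrable.intros]
  and integral_lborel_affine = has_bochner_integral_lborel_affine[THEN has_bochner_integral_integral_eq]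

lemma integrable_continuous_bounded_support:
  fixes f :: "'a::euclidean_space \<Rightarrow> real"
  assumes "continuous_on UNIV f" "bounded {x. f x \<noteq> 0}"
  shows "integrable lborel f"
proof -
  let ?K = "closure {x. f x \<noteq> 0}"
  have "integrable lborel (\<lambda>x. indicator ?K x *\<^sub>R f x)"
    using assms by (intro borel_integrable_compact)
      (auto intro: continuous_on_subset)
  moreover have "(\<lambda>x. indicator ?K x *\<^sub>R f x) = f"
    using closure_subset[of "{x. f x \<noteq> 0}"] by (auto simp: fun_eq_iff indicator_def)
  ultimately show ?thesis by simp
qed

lemma bounded_continuous_bounded_support:
  fixes f :: "'a::euclidean_space \<Rightarrow> real"
  assumes "continuous_on UNIV f" "bounded {x. f x \<noteq> 0}"
  obtains M where "0 < M" "\<And>x. \<bar>f x\<bar> \<le> M"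
proof -
  let ?K = "closure {x. f x \<noteq> 0}"
  have "compact ?K" using assms by simp
  then have "bounded (f ` ?K)"
    using assms by (intro compact_imp_bounded compact_continuous_image) (auto intro: continuous_on_subset)
  then obtain M where M: "0 < M" "\<And>x. x \<in> ?K \<Longrightarrow> \<bar>f x\<bar> \<le> M"
    by (auto simp: bounded_pos)
  have "\<bar>f x\<bar> \<le> M" for x
    using M closure_subset[of "{x. f x \<noteq> 0}"] by (cases "f x = 0") auto
  with M that show ?thesis by blast
qed

text \<open>The common source of every integration by parts below. Translation invariance makes the
  integral of each difference quotient of \<open>H\<close> zero, and dominated convergence passes to
  the derivative. Only a continuous derivative in the single direction \<open>v\<close> is asked
  for.\<close>

lemma integral_directional_derivative_eq_0:
  fixes H h :: "'a::euclidean_space \<Rightarrow> real"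
  assumes H: "continuous_on UNIV H" "bounded {x. H x \<noteq> 0}"
    and h: "continuous_on UNIV h"
    and deriv: "\<And>x. ((\<lambda>t. H (x + t *\<^sub>R v)) has_real_derivative h x) (at 0)"
  shows "integral\<^sup>L lborel h = 0"
proof -
  have deriv': "((\<lambda>t. H (x + t *\<^sub>R v)) has_real_derivative h (x + s *\<^sub>R v)) (at s)" for x s
    using deriv[of "x + s *\<^sub>R v"] DERIV_shift[of "\<lambda>t. H (x + t *\<^sub>R v)" "h (x + s *\<^sub>R v)" 0 s]
    by (simp add: algebra_simps)
  \<comment> \<open>Off the support of \<open>H\<close> the derivative is that of the zero function;
    so \<open>h\<close> too has bounded support and is bounded.\<close>
  have "h x = 0" if x: "x \<notin> closure {x. H x \<noteq> 0}" for x
  proof -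
    let ?U = "(\<lambda>t. x + t *\<^sub>R v) -` (- closure {x. H x \<noteq> 0})"
    have "open ?U" by (intro open_vimage continuous_intros) auto
    moreover have "0 \<in> ?U" using x by simp
    moreover have "((\<lambda>t. 0) has_real_derivative 0) (at 0)" by simp
    ultimately have "((\<lambda>t. H (x + t *\<^sub>R v)) has_real_derivative 0) (at 0)"
      by (elim has_field_derivative_transform_within_open)
        (use closure_subset[of "{x. H x \<noteq> 0}"] in auto)
    with deriv show ?thesis by (rule DERIV_unique)
  qed
  then have "{x. h x \<noteq> 0} \<subseteq> closure {x. H x \<noteq> 0}" by blast
  then have supp_h: "bounded {x. h x \<noteq> 0}"
    using H(2) bounded_closure bounded_subset by blast
  obtain M where M: "0 < M" "\<And>x. \<bar>h x\<bar> \<le> M"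
    using bounded_continuous_bounded_support[OF h supp_h] by blast
  obtain R where R: "\<And>x. H x \<noteq> 0 \<Longrightarrow> norm x \<le> R"
    using H(2) by (auto simp: bounded_iff)
  have intH: "integrable lborel H"
    by (rule integrable_continuous_bounded_support[OF H])
  let ?D = "\<lambda>n x. (H (x + (1 / Suc n) *\<^sub>R v) - H x) * Suc n"
  have shift: "has_bochner_integral lborel (\<lambda>x. H (x + a)) (integral\<^sup>L lborel H)" for a
    using has_bochner_integral_lborel_affine[OF intH, of 1 "- a"] by simp
  have int_D: "integral\<^sup>L lborel (?D n) = 0" for n
  proof -
    have "has_bochner_integral lborel (?D n)
        ((integral\<^sup>L lborel H - integral\<^sup>L lborel H) * Suc n)"
      by (intro has_bochner_integral_mult_left has_bochner_integral_diff shift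
          has_bochner_integral_integrable[OF intH])
    then show ?thesis by (simp add: has_bochner_integral_iff)
  qed
  have "(\<lambda>n. integral\<^sup>L lborel (?D n)) \<longlonglongrightarrow> integral\<^sup>L lborel h"
  proof (rule integral_dominated_convergence)
    show "h \<in> borel_measurable lborel"
      using h by (simp add: borel_measurable_continuous_onI)
    show "?D n \<in> borel_measurable lborel" for n
      using borel_measurable_continuous_onI[OF H(1)] by measurable
    \<comment> \<open>The step lengths \<open>1 / Suc n\<close> are at most 1, so every quotient
      lives in the support enlarged by \<open>norm v\<close>; there the mean value theorem bounds it
      by \<open>M\<close>.\<close>
    show "integrable lborel (\<lambda>x::'a. M * indicator (cball 0 (R + norm v)) x)"
      by (intro integrable_mult_right integrable_real_indicator emeasure_lborel_cball_finite) auto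
    show "AE x in lborel. (\<lambda>n. ?D n x) \<longlonglongrightarrow> h x"
    proof (rule AE_I2)
      fix x
      have "(\<lambda>t. (H (x + t *\<^sub>R v) - H x) / t) \<midarrow>0\<rightarrow> h x"
        using deriv[of x] by (simp add: DERIV_def)
      moreover have "filterlim (\<lambda>n. 1 / real (Suc n)) (at 0) sequentially"
        by (rule filterlim_atI) (use LIMSEQ_inverse_real_of_nat in \<open>auto simp: inverse_eq_divide\<close>)
      ultimately have "(\<lambda>n. (H (x + (1 / real (Suc n)) *\<^sub>R v) - H x) / (1 / real (Suc n))) \<longlonglongrightarrow> h x"
        by (rule filterlim_compose)
      then show "(\<lambda>n. ?D n x) \<longlonglongrightarrow> h x" by simp
    qed
    show "AE x in lborel. norm (?D n x) \<le> M * indicator (cball 0 (R + norm v)) x" for n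
    proof (rule AE_I2)
      fix x :: 'a
      show "norm (?D n x) \<le> M * indicator (cball 0 (R + norm v)) x"
      proof (cases "H (x + (1 / Suc n) *\<^sub>R v) = 0 \<and> H x = 0")
        case False
        have "norm x \<le> R + norm v"
        proof (cases "H x = 0")
          case True
          with False have "norm (x + (1 / Suc n) *\<^sub>R v) \<le> R" using R by blast
          moreover have "norm ((1 / Suc n) *\<^sub>R v) \<le> norm v"
            by (simp add: divide_le_eq mult_le_cancel_left1)
          moreover have "norm x \<le> norm (x + (1 / Suc n) *\<^sub>R v) + norm ((1 / Suc n) *\<^sub>R v)"
            by (metis add_diff_cancel_right' norm_triangle_ineq4)
          ultimately show ?thesis by linarith
        qed (use R[of x] in \<open>simp add: add_increasing2\<close>)
        moreover have "\<bar>?D n x\<bar> \<le> M"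
        proof -
          obtain z where "H (x + (1 / Suc n) *\<^sub>R v) - H (x + 0 *\<^sub>R v) = (1 / Suc n - 0) * h (x + z *\<^sub>R v)"
            using MVT2[of 0 "1 / Suc n" "\<lambda>t. H (x + t *\<^sub>R v)" "\<lambda>s. h (x + s *\<^sub>R v)"] deriv'
            by auto
          then have "?D n x = h (x + z *\<^sub>R v)" by simp
          with M show ?thesis by simp
        qed
        ultimately show ?thesis by simp
      qed (use M in \<open>simp add: less_imp_le\<close>)
    qed
  qed
  then have "(\<lambda>n::nat. 0) \<longlonglongrightarrow> integral\<^sup>L lborel h" by (simp only: int_D)
  then show ?thesis by (simp add: LIMSEQ_const_iff)
qed

lemma DERIV_along_partial:
  assumes "f differentiable (at x)"
  shows "((\<lambda>t. f (x + t *\<^sub>R v)) has_real_derivative partial v f x) (at 0)"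
proof -
  have D: "(f has_derivative frechet_derivative f (at x)) (at x)"
    using assms frechet_derivative_works by blast
  have "((\<lambda>t. x + t *\<^sub>R v) has_derivative (\<lambda>t. t *\<^sub>R v)) (at 0)"
    by (auto intro!: derivative_eq_intros)
  from has_derivative_compose[OF this, of f "frechet_derivative f (at x)"] D
  have "((\<lambda>t. f (x + t *\<^sub>R v)) has_derivative (\<lambda>t. frechet_derivative f (at x) (t *\<^sub>R v))) (at 0)"
    by simp
  moreover have "(\<lambda>t. frechet_derivative f (at x) (t *\<^sub>R v)) = (\<lambda>t. partial v f x * t)"
    using linear_scale[OF has_derivative_linear[OF D]] by (simp add: fun_eq_iff partial_def)
  ultimately show ?thesis by (simp add: has_field_derivative_def)
qed

section \<open>Integrability over the plane by comparison with product functions\<close>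

lemma integrable_lborel_prod_Basis:
  fixes f :: "'a::euclidean_space \<Rightarrow> real \<Rightarrow> real"
  assumes "\<And>b. b \<in> Basis \<Longrightarrow> integrable lborel (f b)"
  shows "integrable lborel (\<lambda>x::'a. \<Prod>b\<in>Basis. f b (x \<bullet> b))"
proof -
  interpret product_sigma_finite "\<lambda>_::'a. lborel :: real measure" ..
  have [measurable]: "b \<in> Basis \<Longrightarrow> f b \<in> borel_measurable borel" for b
    using assms by auto
  have "integrable (\<Pi>\<^sub>M b\<in>Basis. lborel) (\<lambda>x. \<Prod>b\<in>Basis. f b ((\<Sum>c\<in>Basis. x c *\<^sub>R c) \<bullet> b))"
    using product_integrable_prod[OF finite_Basis assms] by simp
  then show ?thesis
    by (subst lborel_eq, subst integrable_distr_eq) simp_all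
qed

lemma Basis_real_2: "Basis = {axis 1 1, axis 2 1 :: real^2}"
proof -
  have "Basis = (\<lambda>i. axis i 1 :: real^2) ` UNIV"
    by (auto simp: Basis_vec_def)
  then show ?thesis by (simp add: UNIV_2)
qed

lemma axis_1_neq_axis_2 [simp]: "axis 1 1 \<noteq> (axis 2 1 :: real^2)"
  by (simp add: axis_eq_axis)

lemma norm_square_real_2: "(norm (x :: real^2))\<^sup>2 = (x $ 1)\<^sup>2 + (x $ 2)\<^sup>2"
  by (simp add: norm_vec_def L2_set_def sum_2)

text \<open>Since \<open>(1 + a) (1 + b) \<le> (1 + a + b)\<^sup>2\<close> for nonnegative
  \<open>a\<close> and \<open>b\<close>, a product of two one-dimensional arctangent integrands
  dominates. The function serves twice: rescaled as an approximate identity, and as a majorant for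
  Gaussian moments.\<close>

lemma integrable_inverse_1_plus_norm_square:
  "integrable lborel (\<lambda>x::real^2. 1 / (1 + (norm x)\<^sup>2)\<^sup>2)"
proof (rule Bochner_Integration.integrable_bound)
  have "integrable lborel (\<lambda>x::real. inverse (1 + x\<^sup>2))"
    using integrable_inverse_1_plus_square by (simp add: set_integrable_def einterval_def)
  then show "integrable lborel (\<lambda>x::real^2. \<Prod>b\<in>Basis. inverse (1 + (x \<bullet> b)\<^sup>2))"
    by (rule integrable_lborel_prod_Basis)
  show "AE x in lborel. norm (1 / (1 + (norm (x::real^2))\<^sup>2)\<^sup>2)
      \<le> norm (\<Prod>b\<in>Basis. inverse (1 + (x \<bullet> b)\<^sup>2))"
  proof (rule AE_I2)
    fix x :: "real^2"
    have "(\<Prod>b\<in>Basis. inverse (1 + (x \<bullet> b)\<^sup>2)) = inverse (1 + (x $ 1)\<^sup>2) * inverse (1 + (x $ 2)\<^sup>2)"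
      by (simp add: Basis_real_2 inner_axis)
    moreover have "(norm x)\<^sup>2 = (x $ 1)\<^sup>2 + (x $ 2)\<^sup>2"
      by (rule norm_square_real_2)
    moreover have "(1 + (x $ 1)\<^sup>2) * (1 + (x $ 2)\<^sup>2) \<le> (1 + ((x $ 1)\<^sup>2 + (x $ 2)\<^sup>2))\<^sup>2"
      unfolding power2_eq_square[of "1 + _"] by (intro mult_mono) auto
    moreover have "0 < (1 + (x $ 1)\<^sup>2) * (1 + (x $ 2)\<^sup>2)"
      by (intro mult_pos_pos add_pos_nonneg) auto
    ultimately have "1 / (1 + (norm x)\<^sup>2)\<^sup>2 \<le> (\<Prod>b\<in>Basis. inverse (1 + (x \<bullet> b)\<^sup>2))"
      unfolding inverse_mult_distrib[symmetric] inverse_eq_divide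
      by (simp add: frac_le)
    then show "norm (1 / (1 + (norm x)\<^sup>2)\<^sup>2) \<le> norm (\<Prod>b\<in>Basis. inverse (1 + (x \<bullet> b)\<^sup>2))"
      by (simp add: abs_mult)
  qed
qed measurable

section \<open>Weak solutions\<close>

abbreviation e1 :: "real^2" where "e1 \<equiv> axis 1 1"
abbreviation e2 :: "real^2" where "e2 \<equiv> axis 2 1"

lemma e1_Basis: "e1 \<in> Basis" and e2_Basis: "e2 \<in> Basis"
  by (auto simp: Basis_real_2)

lemma laplacian_real_2:
  "laplacian f x = partial e1 (partial e1 f) x + partial e2 (partial e2 f) x"
  by (simp add: laplacian_def Basis_real_2)

lemma test_function_laplacian:
  assumes "test_function \<zeta>"
  shows "test_function (laplacian \<zeta>)"
  unfolding laplacian_def[abs_def]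
  by (intro test_function_sum test_function_partial assms) auto

lemma test_function_continuous: "test_function \<zeta> \<Longrightarrow> continuous_on S \<zeta>"
  using Ck_continuous test_function_def by blast

lemma test_function_differentiable: "test_function \<zeta> \<Longrightarrow> \<zeta> differentiable (at x)"
  using Ck_differentiable test_function_def by blast

lemma test_function_bounded_support: "test_function \<zeta> \<Longrightarrow> bounded {x. \<zeta> x \<noteq> 0}"
  by (simp add: test_function_def compact_support_iff_bounded)

lemma test_function_bounded:
  assumes "test_function \<zeta>"
  obtains M where "0 < M" "\<And>x. \<bar>\<zeta> x\<bar> \<le> M"
  using bounded_continuous_bounded_support[OF test_function_continuous[OF assms]
      test_function_bounded_support[OF assms]] by blast

lemma integrable_continuous_times_test:
  fixes w :: "'a::euclidean_space \<Rightarrow> real"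
  assumes "continuous_on UNIV w" "test_function \<zeta>"
  shows "integrable lborel (\<lambda>x. w x * \<zeta> x)"
proof (rule integrable_continuous_bounded_support)
  show "continuous_on UNIV (\<lambda>x. w x * \<zeta> x)"
    using assms test_function_continuous by (intro continuous_on_mult) auto
  show "bounded {x. w x * \<zeta> x \<noteq> 0}"
    using test_function_bounded_support[OF assms(2)] by (rule bounded_subset) auto
qed

lemma integrable_times_test:
  fixes f :: "'a::euclidean_space \<Rightarrow> real"
  assumes f: "integrable lborel f" and \<zeta>: "test_function \<zeta>"
  shows "integrable lborel (\<lambda>x. f x * \<zeta> x)"
proof -
  obtain M where M: "0 < M" "\<And>x. \<bar>\<zeta> x\<bar> \<le> M" using test_function_bounded[OF \<zeta>] by blast
  show ?thesis
  proof (rule Bochner_Integration.integrable_bound)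
    show "integrable lborel (\<lambda>x. f x * M)"
      using f by simp
    have [measurable]: "\<zeta> \<in> borel_measurable borel" "f \<in> borel_measurable borel"
      using test_function_continuous[OF \<zeta>] f by (auto simp: borel_measurable_continuous_onI)
    show "(\<lambda>x. f x * \<zeta> x) \<in> borel_measurable lborel"
      by measurable
    have "norm (f x * \<zeta> x) \<le> norm (f x * M)" for x
      using M(1) M(2)[of x] by (simp add: abs_mult mult_left_mono)
    then show "AE x in lborel. norm (f x * \<zeta> x) \<le> norm (f x * M)"
      by (rule AE_I2)
  qed
qed

text \<open>The distributional form of \<open>\<Delta>w = \<partial>\<^sub>1 f\<close>; moving one
  derivative onto \<open>\<zeta>\<close> changes the sign, hence the plus. Continuity of
  \<open>w\<close> and integrability of \<open>f\<close> make both products integrable.\<close>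

definition weak_sol :: "(real^2 \<Rightarrow> real) \<Rightarrow> (real^2 \<Rightarrow> real) \<Rightarrow> bool" where
  "weak_sol w f \<longleftrightarrow> continuous_on UNIV w \<and> integrable lborel f \<and>
     (\<forall>\<zeta>. test_function \<zeta> \<longrightarrow>
        (\<integral>x. w x * laplacian \<zeta> x + f x * partial e1 \<zeta> x \<partial>lborel) = 0)"

lemma integrable_weak_sol:
  assumes "weak_sol w f" "test_function \<zeta>"
  shows "integrable lborel (\<lambda>x. w x * laplacian \<zeta> x)"
    and "integrable lborel (\<lambda>x. f x * partial e1 \<zeta> x)"
  using integrable_continuous_times_test[OF _ test_function_laplacian[OF assms(2)], of w]
    integrable_times_test[OF _ test_function_partial[OF assms(2) e1_Basis], of f] assms(1)
  by (simp_all add: weak_sol_def)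

lemma weak_sol_sum:
  assumes "\<And>i. i \<in> I \<Longrightarrow> weak_sol (w i) (f i)"
  shows "weak_sol (\<lambda>x. \<Sum>i\<in>I. w i x) (\<lambda>x. \<Sum>i\<in>I. f i x)"
proof -
  have "(\<integral>x. (\<Sum>i\<in>I. w i x) * laplacian \<zeta> x + (\<Sum>i\<in>I. f i x) * partial e1 \<zeta> x \<partial>lborel) = 0"
    if \<zeta>: "test_function \<zeta>" for \<zeta>
  proof -
    have "(\<integral>x. (\<Sum>i\<in>I. w i x) * laplacian \<zeta> x + (\<Sum>i\<in>I. f i x) * partial e1 \<zeta> x \<partial>lborel) =
        (\<integral>x. (\<Sum>i\<in>I. w i x * laplacian \<zeta> x + f i x * partial e1 \<zeta> x) \<partial>lborel)"
      by (simp add: sum_distrib_right sum.distrib)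
    also have "\<dots> = (\<Sum>i\<in>I. \<integral>x. w i x * laplacian \<zeta> x + f i x * partial e1 \<zeta> x \<partial>lborel)"
      using integrable_weak_sol[OF assms \<zeta>]
      by (intro Bochner_Integration.integral_sum Bochner_Integration.integrable_add) auto
    also have "\<dots> = 0"
      using assms \<zeta> by (intro sum.neutral) (auto simp: weak_sol_def)
    finally show ?thesis .
  qed
  with assms show ?thesis
    unfolding weak_sol_def by (auto intro!: continuous_on_sum)
qed

lemma partial_cmult:
  assumes "f differentiable (at x)"
  shows "partial i (\<lambda>x. c * f x) x = c * partial i f x"
proof -
  have "(f has_derivative frechet_derivative f (at x)) (at x)"
    using assms frechet_derivative_works by blast
  from partial_eq[OF has_derivative_mult_right[OF this]] show ?thesis
    by (simp only: partial_def)
qed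

text \<open>The Laplacian produces \<open>a c\<^sup>2\<close>; the derivative
  \<open>\<partial>\<^sub>1\<close> supplies one factor \<open>c\<close>, so \<open>a c\<close> is
  left for the right-hand side.\<close>

lemma weak_sol_affine:
  assumes "weak_sol w f" "c > 0"
  shows "weak_sol (\<lambda>x. a * w (c *\<^sub>R x - p)) (\<lambda>x. a * c * f (c *\<^sub>R x - p))"
proof -
  have cont: "continuous_on UNIV w" and f: "integrable lborel f"
    using assms(1) by (auto simp: weak_sol_def)
  have "continuous_on UNIV (w \<circ> (\<lambda>x. c *\<^sub>R x - p))"
    by (intro continuous_on_compose continuous_intros continuous_on_subset[OF cont]) auto
  then have "continuous_on UNIV (\<lambda>x. a * w (c *\<^sub>R x - p))"
    by (auto intro!: continuous_intros simp: o_def)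
  moreover have "integrable lborel (\<lambda>x. a * c * f (c *\<^sub>R x - p))"
    using integrable_lborel_affine[OF f, of c p] assms(2) by simp
  moreover have "(\<integral>x. a * w (c *\<^sub>R x - p) * laplacian \<zeta> x +
      a * c * f (c *\<^sub>R x - p) * partial e1 \<zeta> x \<partial>lborel) = 0" if \<zeta>: "test_function \<zeta>" for \<zeta>
  proof -
    \<comment> \<open>Composition with the inverse of \<open>x \<mapsto> c x - p\<close>, so that
      the change of variables returns \<open>\<zeta>\<close> itself; the two chain rule factors
      \<open>1 / c\<close> of its Laplacian are repaid by the \<open>c\<^sup>2\<close> inserted
      below.\<close>
    define \<zeta>' where "\<zeta>' = (\<lambda>y. \<zeta> ((1 / c) *\<^sub>R y - (- (1 / c) *\<^sub>R p)))"
    have \<zeta>': "test_function \<zeta>'"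
      unfolding \<zeta>'_def using \<zeta> assms(2) by (intro test_function_affine) auto
    have d1: "partial i \<zeta>' = (\<lambda>y. (1 / c) * partial i \<zeta> ((1 / c) *\<^sub>R y - (- (1 / c) *\<^sub>R p)))" for i
      unfolding \<zeta>'_def using \<zeta> by (intro ext partial_affine test_function_differentiable)
    have d2: "partial i (partial i \<zeta>') y =
        (1 / c) * ((1 / c) * partial i (partial i \<zeta>) ((1 / c) *\<^sub>R y - (- (1 / c) *\<^sub>R p)))"
      if i: "i \<in> Basis" for i y
    proof -
      let ?g = "\<lambda>y. partial i \<zeta> ((1 / c) *\<^sub>R y - (- (1 / c) *\<^sub>R p))"
      have tg: "test_function ?g"
        using \<zeta> assms(2) i by (intro test_function_affine test_function_partial) auto
      have "partial i (\<lambda>y. (1 / c) * ?g y) y = (1 / c) * partial i ?g y"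
        by (rule partial_cmult[OF test_function_differentiable[OF tg]])
      moreover have "partial i ?g y = (1 / c) * partial i (partial i \<zeta>) ((1 / c) *\<^sub>R y - (- (1 / c) *\<^sub>R p))"
        using \<zeta> i by (intro partial_affine test_function_differentiable test_function_partial)
      ultimately show ?thesis by (simp add: d1)
    qed
    let ?G = "\<lambda>y. w y * laplacian \<zeta>' y + f y * partial e1 \<zeta>' y"
    have "integrable lborel ?G"
      using integrable_weak_sol[OF assms(1) \<zeta>'] by auto
    from integral_lborel_affine[OF this, of c p]
    have "(\<integral>x. ?G (c *\<^sub>R x - p) \<partial>lborel) = 0"
      using assms \<zeta>' by (simp add: weak_sol_def)
    then have "(\<integral>x. a * c\<^sup>2 * ?G (c *\<^sub>R x - p) \<partial>lborel) = 0"
      by simp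
    also have "(\<lambda>x. a * c\<^sup>2 * ?G (c *\<^sub>R x - p)) =
        (\<lambda>x. a * w (c *\<^sub>R x - p) * laplacian \<zeta> x + a * c * f (c *\<^sub>R x - p) * partial e1 \<zeta> x)"
    proof
      fix x
      have "(1 / c) *\<^sub>R (c *\<^sub>R x - p) - (- (1 / c) *\<^sub>R p) = x"
        using assms(2) by (simp add: algebra_simps)
      then show "a * c\<^sup>2 * ?G (c *\<^sub>R x - p) =
          a * w (c *\<^sub>R x - p) * laplacian \<zeta> x + a * c * f (c *\<^sub>R x - p) * partial e1 \<zeta> x"
        using assms(2) unfolding laplacian_real_2 d2[OF e1_Basis] d2[OF e2_Basis] unfolding d1
        by (simp add: field_simps power2_eq_square)
    qed
    finally show ?thesis .
  qed
  ultimately show ?thesis by (simp add: weak_sol_def)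
qed

text \<open>Uniform convergence keeps the sum of the \<open>w n\<close> continuous, while for the
  \<open>f n\<close> summable L1 norms are enough. Tested against \<open>\<zeta>\<close>, both
  series are dominated, as \<open>laplacian \<zeta>\<close> is integrable and
  \<open>partial e1 \<zeta>\<close> bounded; this permits termwise integration.\<close>

lemma weak_sol_suminf:
  assumes sol: "\<And>n. weak_sol (w n) (f n)"
    and w: "\<And>n x. \<bar>w n x\<bar> \<le> B n" "summable B"
    and f: "summable (\<lambda>n. \<integral>x. \<bar>f n x\<bar> \<partial>lborel)" "\<And>x. summable (\<lambda>n. \<bar>f n x\<bar>)"
  shows "weak_sol (\<lambda>x. \<Sum>n. w n x) (\<lambda>x. \<Sum>n. f n x)"
proof -
  have cont: "continuous_on UNIV (w n)" and f_int: "integrable lborel (f n)" for n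
    using sol[of n] by (simp_all add: weak_sol_def)
  have sw: "summable (\<lambda>n. \<bar>w n x\<bar>)" for x
    by (rule summable_comparison_test'[OF w(2), of 0]) (use w(1) in simp)
  have "uniform_limit UNIV (\<lambda>n x. \<Sum>i<n. w i x) (\<lambda>x. \<Sum>n. w n x) sequentially"
    by (rule Weierstrass_m_test[OF _ w(2)]) (use w(1) in simp)
  then have "continuous_on UNIV (\<lambda>x. \<Sum>n. w n x)"
    by (rule uniform_limit_theorem[rotated]) (auto intro!: always_eventually continuous_on_sum cont)
  moreover have "integrable lborel (\<lambda>x. \<Sum>n. f n x)"
    using f f_int by (intro integrable_suminf) auto
  moreover have "(\<integral>x. (\<Sum>n. w n x) * laplacian \<zeta> x + (\<Sum>n. f n x) * partial e1 \<zeta> x \<partial>lborel) = 0"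
    if \<zeta>: "test_function \<zeta>" for \<zeta>
  proof -
    let ?g = "\<lambda>n x. w n x * laplacian \<zeta> x + f n x * partial e1 \<zeta> x"
    have L: "test_function (laplacian \<zeta>)" and P: "test_function (partial e1 \<zeta>)"
      using \<zeta> by (auto intro: test_function_laplacian test_function_partial e1_Basis)
    obtain M where M: "0 < M" "\<And>x. \<bar>partial e1 \<zeta> x\<bar> \<le> M"
      using test_function_bounded[OF P] by blast
    have g_int: "integrable lborel (?g n)" for n
      using integrable_weak_sol[OF sol \<zeta>] by auto
    have Lint: "integrable lborel (\<lambda>x. \<bar>laplacian \<zeta> x\<bar>)"
      using integrable_continuous_times_test[OF continuous_on_const L, of 1] by simp
    have norm_g: "norm (?g n x) \<le> \<bar>w n x\<bar> * \<bar>laplacian \<zeta> x\<bar> + \<bar>f n x\<bar> * \<bar>partial e1 \<zeta> x\<bar>" for n x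
      using norm_triangle_ineq[of "w n x * laplacian \<zeta> x" "f n x * partial e1 \<zeta> x"]
      by (simp add: abs_mult)
    have sums: "summable (\<lambda>n. norm (?g n x))" for x
    proof (rule summable_comparison_test'[of "\<lambda>n. \<bar>w n x\<bar> * \<bar>laplacian \<zeta> x\<bar> + \<bar>f n x\<bar> * \<bar>partial e1 \<zeta> x\<bar>" 0])
      show "summable (\<lambda>n. \<bar>w n x\<bar> * \<bar>laplacian \<zeta> x\<bar> + \<bar>f n x\<bar> * \<bar>partial e1 \<zeta> x\<bar>)"
        by (intro summable_add summable_mult2 sw f)
    qed (use norm_g in simp)
    have "summable (\<lambda>n. \<integral>x. norm (?g n x) \<partial>lborel)"
    proof (rule summable_comparison_test'[of
          "\<lambda>n. B n * (\<integral>x. \<bar>laplacian \<zeta> x\<bar> \<partial>lborel) + (\<integral>x. \<bar>f n x\<bar> \<partial>lborel) * M" 0])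
      show "summable (\<lambda>n. B n * (\<integral>x. \<bar>laplacian \<zeta> x\<bar> \<partial>lborel) + (\<integral>x. \<bar>f n x\<bar> \<partial>lborel) * M)"
        by (intro summable_add summable_mult2 w f)
      fix n :: nat
      have "(\<integral>x. norm (?g n x) \<partial>lborel) \<le> (\<integral>x. B n * \<bar>laplacian \<zeta> x\<bar> + \<bar>f n x\<bar> * M \<partial>lborel)"
      proof (rule integral_mono)
        show "integrable lborel (\<lambda>x. B n * \<bar>laplacian \<zeta> x\<bar> + \<bar>f n x\<bar> * M)"
          using Lint f_int by auto
        show "norm (?g n x) \<le> B n * \<bar>laplacian \<zeta> x\<bar> + \<bar>f n x\<bar> * M" for x
        proof -
          have "norm (?g n x) \<le> \<bar>w n x\<bar> * \<bar>laplacian \<zeta> x\<bar> + \<bar>f n x\<bar> * \<bar>partial e1 \<zeta> x\<bar>"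
            by (rule norm_g)
          also have "\<dots> \<le> B n * \<bar>laplacian \<zeta> x\<bar> + \<bar>f n x\<bar> * M"
            using w(1) M by (intro add_mono mult_right_mono mult_left_mono) auto
          finally show ?thesis .
        qed
      qed (use g_int in auto)
      also have "\<dots> = B n * (\<integral>x. \<bar>laplacian \<zeta> x\<bar> \<partial>lborel) + (\<integral>x. \<bar>f n x\<bar> \<partial>lborel) * M"
        using Lint f_int by simp
      finally show "norm (\<integral>x. norm (?g n x) \<partial>lborel) \<le>
          B n * (\<integral>x. \<bar>laplacian \<zeta> x\<bar> \<partial>lborel) + (\<integral>x. \<bar>f n x\<bar> \<partial>lborel) * M"
        by simp
    qed
    then have "(\<integral>x. (\<Sum>n. ?g n x) \<partial>lborel) = (\<Sum>n. \<integral>x. ?g n x \<partial>lborel)"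
      using g_int sums by (intro integral_suminf) auto
    also have "\<dots> = 0"
      using sol \<zeta> by (simp add: weak_sol_def)
    also have "(\<lambda>x. \<Sum>n. ?g n x) = (\<lambda>x. (\<Sum>n. w n x) * laplacian \<zeta> x + (\<Sum>n. f n x) * partial e1 \<zeta> x)"
    proof
      fix x
      have "(\<lambda>n. ?g n x) sums ((\<Sum>n. w n x) * laplacian \<zeta> x + (\<Sum>n. f n x) * partial e1 \<zeta> x)"
        using summable_rabs_cancel[OF sw] summable_rabs_cancel[OF f(2)]
        by (intro sums_add sums_mult2 summable_sums)
      then show "(\<Sum>n. ?g n x) = (\<Sum>n. w n x) * laplacian \<zeta> x + (\<Sum>n. f n x) * partial e1 \<zeta> x"
        by (rule sums_unique[symmetric])
    qed
    finally show ?thesis .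
  qed
  ultimately show ?thesis by (simp add: weak_sol_def)
qed

lemma abs_sum_le_if_disjoint:
  fixes g :: "'i \<Rightarrow> real"
  assumes "finite I" "0 \<le> B" "\<And>i. i \<in> I \<Longrightarrow> \<bar>g i\<bar> \<le> B"
    and "\<And>i j. i \<in> I \<Longrightarrow> j \<in> I \<Longrightarrow> i \<noteq> j \<Longrightarrow> g i \<noteq> 0 \<Longrightarrow> g j = 0"
  shows "\<bar>\<Sum>i\<in>I. g i\<bar> \<le> B"
proof (cases "\<exists>i\<in>I. g i \<noteq> 0")
  case True
  then obtain i where i: "i \<in> I" "g i \<noteq> 0" by blast
  have "(\<Sum>j\<in>I. g j) = (\<Sum>j\<in>{i}. g j)"
    using i assms by (intro sum.mono_neutral_right) auto
  with i assms show ?thesis by simp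
qed (use assms in simp)

section \<open>Radial profiles and dipole solutions\<close>

lemma continuous_real_comp:
  fixes g :: "real \<Rightarrow> real"
  assumes "continuous_on {0..} g"
  shows "continuous_on UNIV (\<lambda>x::real^2. g ((norm x)\<^sup>2))"
  using assms by (intro continuous_on_compose2[OF assms] continuous_intros) auto

lemma DERIV_radial:
  fixes \<phi> \<phi>' :: "real \<Rightarrow> real"
  assumes \<phi>: "\<And>s. 0 \<le> s \<Longrightarrow> (\<phi> has_real_derivative \<phi>' s) (at s)"
  shows "((\<lambda>t. \<phi> ((norm (x + t *\<^sub>R e1))\<^sup>2)) has_real_derivative \<phi>' ((norm x)\<^sup>2) * (2 * x $ 1)) (at 0)"
  "((\<lambda>t. \<phi> ((norm (x + t *\<^sub>R e2))\<^sup>2)) has_real_derivative \<phi>' ((norm x)\<^sup>2) * (2 * x $ 2)) (at 0)"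
proof -
  have "((\<lambda>t. (norm (x + t *\<^sub>R e1))\<^sup>2) has_real_derivative 2 * x $ 1) (at 0)"
    "((\<lambda>t. (norm (x + t *\<^sub>R e2))\<^sup>2) has_real_derivative 2 * x $ 2) (at 0)"
    by (auto simp: norm_square_real_2 axis_def intro!: derivative_eq_intros)
  from this[THEN DERIV_chain2[OF \<phi>, rotated]] show
    "((\<lambda>t. \<phi> ((norm (x + t *\<^sub>R e1))\<^sup>2)) has_real_derivative \<phi>' ((norm x)\<^sup>2) * (2 * x $ 1)) (at 0)"
    "((\<lambda>t. \<phi> ((norm (x + t *\<^sub>R e2))\<^sup>2)) has_real_derivative \<phi>' ((norm x)\<^sup>2) * (2 * x $ 2)) (at 0)"
    by simp_all
qed

lemma continuous_radial:
  fixes \<phi> \<phi>' :: "real \<Rightarrow> real"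
  assumes \<phi>: "\<And>s. 0 \<le> s \<Longrightarrow> (\<phi> has_real_derivative \<phi>' s) (at s)"
  shows "continuous_on UNIV (\<lambda>x::real^2. \<phi> ((norm x)\<^sup>2))"
proof -
  have "continuous_on {0..} \<phi>"
    using DERIV_isCont[OF \<phi>] by (simp add: continuous_at_imp_continuous_on)
  then show ?thesis by (rule continuous_real_comp)
qed

lemma DERIV_coordinate:
  "((\<lambda>t. (x + t *\<^sub>R e1) $ 1) has_real_derivative 1) (at 0)"
  "((\<lambda>t. (x + t *\<^sub>R e2) $ 1) has_real_derivative 0) (at 0)"
  "((\<lambda>t. (x + t *\<^sub>R e2) $ 2) has_real_derivative 1) (at 0)"
  "((\<lambda>t. (norm (x + t *\<^sub>R e1))\<^sup>2) has_real_derivative 2 * x $ 1) (at 0)"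
  by (auto simp: norm_square_real_2 axis_def intro!: derivative_eq_intros)

text \<open>For \<open>w = x\<^sub>1 \<phi>(\<bar>x\<bar>\<^sup>2)\<close> one has \<open>\<Delta>w = \<partial>\<^sub>1 f\<close> with \<open>f = 2 (s \<phi>(s))'\<close> at \<open>s = \<bar>x\<bar>\<^sup>2\<close>.\<close>

lemma weak_sol_dipole:
  fixes \<phi> \<phi>' \<phi>'' :: "real \<Rightarrow> real"
  assumes \<phi>: "\<And>s. 0 \<le> s \<Longrightarrow> (\<phi> has_real_derivative \<phi>' s) (at s)"
    and \<phi>': "\<And>s. 0 \<le> s \<Longrightarrow> (\<phi>' has_real_derivative \<phi>'' s) (at s)"
    and \<phi>'': "continuous_on {0..} \<phi>''"
    and supp: "\<And>s. 1 \<le> s \<Longrightarrow> \<phi> s = 0" "\<And>s. 1 \<le> s \<Longrightarrow> \<phi>' s = 0"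
  shows "weak_sol (\<lambda>x. x $ 1 * \<phi> ((norm x)\<^sup>2)) (\<lambda>x. 2 * (\<phi> ((norm x)\<^sup>2) + (norm x)\<^sup>2 * \<phi>' ((norm x)\<^sup>2)))"
proof -
  let ?w = "\<lambda>x::real^2. x $ 1 * \<phi> ((norm x)\<^sup>2)"
  let ?f = "\<lambda>x::real^2. 2 * (\<phi> ((norm x)\<^sup>2) + (norm x)\<^sup>2 * \<phi>' ((norm x)\<^sup>2))"
  let ?w1 = "\<lambda>x::real^2. \<phi> ((norm x)\<^sup>2) + 2 * (x $ 1)\<^sup>2 * \<phi>' ((norm x)\<^sup>2)"
  let ?w2 = "\<lambda>x::real^2. 2 * (x $ 1 * x $ 2) * \<phi>' ((norm x)\<^sup>2)"
  let ?w11 = "\<lambda>x::real^2. 6 * x $ 1 * \<phi>' ((norm x)\<^sup>2) + 4 * (x $ 1)^3 * \<phi>'' ((norm x)\<^sup>2)"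
  let ?w22 = "\<lambda>x::real^2. 2 * x $ 1 * \<phi>' ((norm x)\<^sup>2) + 4 * (x $ 1 * (x $ 2)\<^sup>2) * \<phi>'' ((norm x)\<^sup>2)"
  let ?f1 = "\<lambda>x::real^2. 8 * x $ 1 * \<phi>' ((norm x)\<^sup>2) + 4 * (x $ 1 * (norm x)\<^sup>2) * \<phi>'' ((norm x)\<^sup>2)"
  have cont: "continuous_on UNIV (\<lambda>x::real^2. \<phi> ((norm x)\<^sup>2))"
    "continuous_on UNIV (\<lambda>x::real^2. \<phi>' ((norm x)\<^sup>2))"
    "continuous_on UNIV (\<lambda>x::real^2. \<phi>'' ((norm x)\<^sup>2))"
    using \<phi> \<phi>' \<phi>'' by (auto intro: continuous_radial continuous_real_comp)
  note radial = DERIV_radial[of \<phi> \<phi>', OF \<phi>, simplified] DERIV_radial[of \<phi>' \<phi>'', OF \<phi>', simplified]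
  have cont_w: "continuous_on UNIV ?w"
    by (intro continuous_intros cont)
  have cont_f: "continuous_on UNIV ?f"
    by (intro continuous_intros cont)
  have "bounded {x. ?f x \<noteq> 0}"
  proof (rule bounded_subset[OF bounded_ball[of 0 1]])
    have "?f x = 0" if "x \<notin> ball 0 1" for x
      using supp[OF one_le_power[of "norm x" 2]] that by simp
    then show "{x. ?f x \<noteq> 0} \<subseteq> ball 0 1" by blast
  qed
  with cont_f have f: "integrable lborel ?f"
    by (rule integrable_continuous_bounded_support)
  have "(\<integral>x. ?w x * laplacian \<zeta> x + ?f x * partial e1 \<zeta> x \<partial>lborel) = 0"
    if \<zeta>: "test_function \<zeta>" for \<zeta>
  proof -
    have Z1: "test_function (partial e1 \<zeta>)" and Z2: "test_function (partial e2 \<zeta>)"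
      using \<zeta> by (auto intro: test_function_partial e1_Basis e2_Basis)
    have Z11: "test_function (partial e1 (partial e1 \<zeta>))" and Z22: "test_function (partial e2 (partial e2 \<zeta>))"
      using Z1 Z2 by (auto intro: test_function_partial e1_Basis e2_Basis)
    note tc = test_function_continuous[OF \<zeta>] test_function_continuous[OF Z1]
      test_function_continuous[OF Z2] test_function_continuous[OF Z11] test_function_continuous[OF Z22]
    \<comment> \<open>\<open>?H1\<close> and \<open>?H2\<close> are the components of Green's vector
      field \<open>w \<nabla>\<zeta> - \<zeta> \<nabla>w + f \<zeta> e1\<close>, whose divergence is
      \<open>w \<Delta>\<zeta> + f \<partial>\<^sub>1 \<zeta> - \<zeta> (\<Delta>w -
      \<partial>\<^sub>1 f)\<close>.\<close>
    let ?H1 = "\<lambda>x::real^2. ?w x * partial e1 \<zeta> x - \<zeta> x * ?w1 x + ?f x * \<zeta> x"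
    let ?h1 = "\<lambda>x::real^2. ?w x * partial e1 (partial e1 \<zeta>) x - \<zeta> x * ?w11 x + ?f1 x * \<zeta> x + ?f x * partial e1 \<zeta> x"
    let ?H2 = "\<lambda>x::real^2. ?w x * partial e2 \<zeta> x - \<zeta> x * ?w2 x"
    let ?h2 = "\<lambda>x::real^2. ?w x * partial e2 (partial e2 \<zeta>) x - \<zeta> x * ?w22 x"
    note D = DERIV_along_partial[OF test_function_differentiable]
    have supp\<zeta>: "bounded ({x. \<zeta> x \<noteq> 0} \<union> {x. partial e1 \<zeta> x \<noteq> 0} \<union> {x. partial e2 \<zeta> x \<noteq> 0})"
      using test_function_bounded_support \<zeta> Z1 Z2 by auto
    have cont_h: "continuous_on UNIV ?h1" "continuous_on UNIV ?h2"
      by (intro continuous_intros cont tc)+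
    have "integral\<^sup>L lborel ?h1 = 0"
    proof (rule integral_directional_derivative_eq_0)
      show "continuous_on UNIV ?H1" by (intro continuous_intros cont tc)
      show "bounded {x. ?H1 x \<noteq> 0}" by (rule bounded_subset[OF supp\<zeta>]) auto
      show "((\<lambda>t. ?H1 (x + t *\<^sub>R e1)) has_real_derivative ?h1 x) (at 0)" for x
        by (rule derivative_eq_intros radial DERIV_coordinate
            D[OF \<zeta>] D[OF Z1] refl)+
          (simp add: algebra_simps power2_eq_square power3_eq_cube)
    qed (rule cont_h)
    moreover have "integral\<^sup>L lborel ?h2 = 0"
    proof (rule integral_directional_derivative_eq_0)
      show "continuous_on UNIV ?H2" by (intro continuous_intros cont tc)
      show "bounded {x. ?H2 x \<noteq> 0}" by (rule bounded_subset[OF supp\<zeta>]) auto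
      show "((\<lambda>t. ?H2 (x + t *\<^sub>R e2)) has_real_derivative ?h2 x) (at 0)" for x
        by (rule derivative_eq_intros radial DERIV_coordinate
            D[OF \<zeta>] D[OF Z2] refl)+
          (simp add: algebra_simps power2_eq_square power3_eq_cube)
    qed (rule cont_h)
    moreover have K: "bounded ({x. \<zeta> x \<noteq> 0} \<union> {x. partial e1 \<zeta> x \<noteq> 0} \<union>
        {x. partial e1 (partial e1 \<zeta>) x \<noteq> 0} \<union> {x. partial e2 (partial e2 \<zeta>) x \<noteq> 0})"
      using test_function_bounded_support \<zeta> Z1 Z11 Z22 by auto
    have "bounded {x. ?h1 x \<noteq> 0}" "bounded {x. ?h2 x \<noteq> 0}"
      by (rule bounded_subset[OF K]; auto)+
    then have "integrable lborel ?h1" "integrable lborel ?h2"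
      using cont_h integrable_continuous_bounded_support by blast+
    ultimately have "(\<integral>x. ?h1 x + ?h2 x \<partial>lborel) = 0" by simp
    \<comment> \<open>The terms with \<open>\<zeta>\<close> cancel because
      \<open>?w11 + ?w22 = ?f1\<close> once the squared norm is written in coordinates.\<close>
    moreover have "?h1 x + ?h2 x = ?w x * laplacian \<zeta> x + ?f x * partial e1 \<zeta> x" for x
      unfolding laplacian_real_2 norm_square_real_2
      by (simp add: algebra_simps power2_eq_square power3_eq_cube)
    ultimately show ?thesis by (simp only:)
  qed
  with cont_w f show ?thesis by (simp add: weak_sol_def)
qed

text \<open>The classical derivative of \<open>x\<^sub>1 \<phi>\<close> in direction 2 is
  \<open>2 x\<^sub>1 x\<^sub>2 \<phi>'\<close>. Where \<open>\<phi>'\<close> is negative and both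
  coordinates are positive, the new integrand has the sign of \<open>\<eta>\<close>, which makes
  lower bounds possible.\<close>

lemma integral_dipole_partial:
  fixes \<phi> \<phi>' :: "real \<Rightarrow> real"
  assumes \<phi>: "\<And>s. 0 \<le> s \<Longrightarrow> (\<phi> has_real_derivative \<phi>' s) (at s)"
    and \<phi>': "continuous_on {0..} \<phi>'" and \<eta>: "test_function \<eta>"
  shows "(\<integral>x. x $ 1 * \<phi> ((norm x)\<^sup>2) * partial e2 \<eta> x \<partial>lborel) =
    (\<integral>x. - (2 * (x $ 1 * x $ 2) * \<phi>' ((norm x)\<^sup>2)) * \<eta> x \<partial>lborel)"
proof -
  let ?a = "\<lambda>x::real^2. x $ 1 * \<phi> ((norm x)\<^sup>2) * partial e2 \<eta> x"
  let ?b = "\<lambda>x::real^2. - (2 * (x $ 1 * x $ 2) * \<phi>' ((norm x)\<^sup>2)) * \<eta> x"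
  have P: "test_function (partial e2 \<eta>)"
    using \<eta> by (auto intro: test_function_partial e2_Basis)
  have cont\<phi>: "continuous_on UNIV (\<lambda>x::real^2. \<phi> ((norm x)\<^sup>2))"
    using \<phi> by (rule continuous_radial)
  note radial = DERIV_radial[of \<phi> \<phi>', OF \<phi>, simplified]
  note cont = cont\<phi> continuous_real_comp[OF \<phi>']
    test_function_continuous[OF \<eta>] test_function_continuous[OF P]
  have "(\<integral>x. ?a x - ?b x \<partial>lborel) = 0"
  proof (rule integral_directional_derivative_eq_0)
    show "continuous_on UNIV (\<lambda>x::real^2. x $ 1 * \<phi> ((norm x)\<^sup>2) * \<eta> x)"
      by (intro continuous_intros cont)
    show "bounded {x::real^2. x $ 1 * \<phi> ((norm x)\<^sup>2) * \<eta> x \<noteq> 0}"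
      by (rule bounded_subset[OF test_function_bounded_support[OF \<eta>]]) auto
    show "continuous_on UNIV (\<lambda>x. ?a x - ?b x)"
      by (intro continuous_intros cont)
    show "((\<lambda>t. (x + t *\<^sub>R e2) $ 1 * \<phi> ((norm (x + t *\<^sub>R e2))\<^sup>2) * \<eta> (x + t *\<^sub>R e2))
        has_real_derivative ?a x - ?b x) (at 0)" for x
      by (rule derivative_eq_intros radial DERIV_coordinate
          DERIV_along_partial[OF test_function_differentiable[OF \<eta>]] refl)+
        (simp add: algebra_simps)
  qed
  moreover have "integrable lborel ?a" "integrable lborel ?b"
    by (intro integrable_continuous_times_test continuous_intros cont P \<eta>)+
  ultimately show ?thesis by simp
qed

section \<open>Packets\<close>

lemma integral_continuous_pos:
  fixes g :: "'a::euclidean_space \<Rightarrow> real"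
  assumes g: "continuous_on UNIV g" "integrable lborel g" and nonneg: "\<And>x. 0 \<le> g x" and pos: "0 < g x0"
  shows "0 < integral\<^sup>L lborel g"
proof (rule ccontr)
  assume "\<not> ?thesis"
  moreover have "0 \<le> integral\<^sup>L lborel g"
    using nonneg by simp
  ultimately have "integral\<^sup>L lborel g = 0" by linarith
  then have "AE x in lborel. g x = 0"
    using integral_nonneg_eq_0_iff_AE[OF g(2)] nonneg by simp
  moreover have op: "open {x. g x \<noteq> 0}"
    using g(1) by (intro open_Collect_neq) auto
  ultimately have "{x. g x \<noteq> 0} \<in> null_sets lborel"
    by (subst AE_iff_null_sets) auto
  then have "negligible {x. g x \<noteq> 0}"
    by (simp add: negligible_iff_null_sets null_sets_completionI)
  then show False
    using open_not_negligible[OF op] pos by force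
qed

text \<open>The exponent starts at 2, where the corner at 0 disappears. Applied with exponents 3 and
  2 it gives the cubic profile of the dipole a continuous second derivative, as
  \<open>weak_sol_dipole\<close> demands.\<close>

lemma DERIV_max_power:
  "((\<lambda>t::real. max 0 t ^ Suc (Suc n)) has_real_derivative real (Suc (Suc n)) * max 0 t ^ Suc n) (at t)"
proof -
  consider "t > 0" | "t < 0" | "t = 0" by linarith
  then show ?thesis
  proof cases
    case 1
    have "((\<lambda>t::real. t ^ Suc (Suc n)) has_real_derivative real (Suc (Suc n)) * max 0 t ^ Suc n) (at t)"
      using 1 by (auto intro!: derivative_eq_intros simp del: power_Suc)
    then show ?thesis
      by (rule has_field_derivative_transform_within_open[where S = "{0<..}"]) (use 1 in auto)
  next
    case 2
    have "((\<lambda>t::real. 0) has_real_derivative real (Suc (Suc n)) * max 0 t ^ Suc n) (at t)"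
      using 2 by simp
    then show ?thesis
      by (rule has_field_derivative_transform_within_open[where S = "{..<0}"]) (use 2 in auto)
  next
    case 3
    have "((\<lambda>h::real. max 0 h ^ Suc n) \<longlongrightarrow> max 0 0 ^ Suc n) (at 0)"
      by (intro tendsto_intros)
    then have "((\<lambda>h::real. max 0 h ^ Suc n) \<longlongrightarrow> 0) (at 0)" by simp
    moreover have "\<forall>\<^sub>F h::real in at 0. max 0 h ^ Suc n = (max 0 (0 + h) ^ Suc (Suc n) - max 0 0 ^ Suc (Suc n)) / h"
      by (auto simp: eventually_at_filter max_def)
    ultimately have "((\<lambda>h::real. (max 0 (0 + h) ^ Suc (Suc n) - max 0 0 ^ Suc (Suc n)) / h) \<longlongrightarrow> 0) (at 0)"
      by (rule Lim_transform_eventually)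
    then show ?thesis using 3 by (simp add: DERIV_def)
  qed
qed

section \<open>Packets and bump functions at dyadic scales\<close>

definition square :: "(real^2) set" where
  "square = {x. \<bar>x $ 1\<bar> < 1 \<and> \<bar>x $ 2\<bar> < 1}"

text \<open>By duality \<open>K\<close> is a lower bound for the total variation of
  \<open>\<partial>\<^sub>2 w\<close>, expressed through a test function of modulus at most 1.
  Keeping \<open>w\<close>, \<open>f\<close> and \<open>\<eta>\<close> in the same square lets
  packets be moved, shrunk and combined without interaction.\<close>

definition packet ::
  "real \<Rightarrow> real \<Rightarrow> real \<Rightarrow> (real^2 \<Rightarrow> real) \<Rightarrow> (real^2 \<Rightarrow> real) \<Rightarrow> (real^2 \<Rightarrow> real) \<Rightarrow> bool" where
  "packet B C K w f \<eta> \<longleftrightarrow>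
     weak_sol w f \<and> test_function \<eta> \<and>
     (\<forall>x. x \<notin> square \<longrightarrow> w x = 0 \<and> f x = 0 \<and> \<eta> x = 0) \<and>
     (\<forall>x. \<bar>w x\<bar> \<le> B) \<and> (\<integral>x. \<bar>f x\<bar> \<partial>lborel) \<le> C \<and>
     (\<forall>x. \<bar>\<eta> x\<bar> \<le> 1) \<and> K \<le> (\<integral>x. w x * partial e2 \<eta> x \<partial>lborel)"

text \<open>The affine map takes [1, 2] onto [-2, 2], outside which \<open>plateau\<close>
  vanishes.\<close>

definition bump :: "real \<Rightarrow> real" where
  "bump t = plateau (4 * t - 6)"

text \<open>Placed in the positive quadrant at distance of order \<open>1 / 2 ^ k\<close> from the
  origin: there \<open>x\<^sub>1 x\<^sub>2\<close> is positive and of order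
  \<open>1 / 4 ^ k\<close>, so the derivative of the dipole keeps one sign and the contributions of
  different scales add up.\<close>

definition dyadic_bump :: "nat \<Rightarrow> real^2 \<Rightarrow> real" where
  "dyadic_bump k x = bump (2 ^ k * x $ 1) * bump (2 ^ k * x $ 2)"

lemma bump_bounds: "0 \<le> bump t" "bump t \<le> 1"
  by (auto simp: bump_def plateau_bounds)

lemma bump_nonzero: "bump t \<noteq> 0 \<Longrightarrow> 1 < t \<and> t < 2"
  unfolding bump_def using plateau_eq_0[of "4 * t - 6"] by (smt (verit))

lemma dyadic_bump_nonzero:
  assumes "dyadic_bump k x \<noteq> 0"
  shows "1 < 2 ^ k * x $ 1" "2 ^ k * x $ 1 < 2" "1 < 2 ^ k * x $ 2" "2 ^ k * x $ 2 < 2"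
  using assms bump_nonzero by (auto simp: dyadic_bump_def)

lemma dyadic_bump_bounds: "0 \<le> dyadic_bump k x" "dyadic_bump k x \<le> 1"
  by (auto simp: dyadic_bump_def bump_bounds mult_le_one)

lemma dyadic_bump_scale: "dyadic_bump k x = dyadic_bump 0 (2 ^ k *\<^sub>R x - 0)"
  by (simp add: dyadic_bump_def)

lemma test_function_dyadic_bump: "test_function (dyadic_bump k)"
proof -
  have "Ck n (\<lambda>x::real^2. plateau (-6 + 4 * (x \<bullet> e1)) * plateau (-6 + 4 * (x \<bullet> e2)))" for n
    by (intro Ck_mult Ck_real_comp_inner Ck_plateau)
  then have "Ck n (dyadic_bump 0)" for n
    by (simp add: dyadic_bump_def[abs_def] bump_def inner_axis)
  moreover have "norm x \<le> 4" if "dyadic_bump 0 x \<noteq> 0" for x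
    using dyadic_bump_nonzero[OF that] norm_le_l1_cart[of x] by (simp add: sum_2)
  then have "compact_support (dyadic_bump 0)"
    unfolding compact_support_iff_bounded bounded_iff by blast
  ultimately have "test_function (dyadic_bump 0)"
    by (simp add: test_function_def)
  then have "test_function (\<lambda>x. dyadic_bump 0 (2 ^ k *\<^sub>R x - 0))"
    by (rule test_function_affine) simp
  then show ?thesis by (simp add: dyadic_bump_scale[of k, abs_def])
qed

lemma integrable_dyadic_bump: "integrable lborel (dyadic_bump k)"
  using integrable_continuous_times_test[OF continuous_on_const test_function_dyadic_bump, of 1] by simp

lemma integral_dyadic_bump:
  "integral\<^sup>L lborel (dyadic_bump k) = integral\<^sup>L lborel (dyadic_bump 0) / 4 ^ k"
proof -
  have "(2::real) ^ k * 2 ^ k = 4 ^ k"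
    by (simp flip: power_mult_distrib)
  then show ?thesis
    using integral_lborel_affine[OF integrable_dyadic_bump[of 0], of "2 ^ k" 0]
    by (simp add: dyadic_bump_scale[of k, abs_def] power2_eq_square)
qed

lemma integral_dyadic_bump_pos: "0 < integral\<^sup>L lborel (dyadic_bump 0)"
proof (rule integral_continuous_pos)
  show "continuous_on UNIV (dyadic_bump 0)"
    by (rule test_function_continuous[OF test_function_dyadic_bump])
  show "0 < dyadic_bump 0 (\<chi> i. 3/2)"
    by (simp add: dyadic_bump_def bump_def plateau_eq_1)
qed (auto simp: integrable_dyadic_bump dyadic_bump_bounds)

lemma partial_sum:
  assumes "\<And>i. i \<in> I \<Longrightarrow> test_function (f i)"
  shows "partial v (\<lambda>x. \<Sum>i\<in>I. f i x) x = (\<Sum>i\<in>I. partial v (f i) x)"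
proof -
  have "((\<lambda>x. \<Sum>i\<in>I. f i x) has_derivative (\<lambda>h. \<Sum>i\<in>I. frechet_derivative (f i) (at x) h)) (at x)"
    using assms by (intro has_derivative_sum test_function_has_derivative)
  from partial_eq[OF this] show ?thesis by (simp add: partial_def)
qed

text \<open>In dimension two the dilation by \<open>sqrt \<delta>\<close> has Jacobian
  \<open>\<delta>\<close>, which cancels the prefactor \<open>1 / \<delta>\<close>; the mass is the
  same for every \<open>\<delta>\<close>.\<close>

lemma integral_inverse_norm_square_scaled:
  fixes \<delta> :: real
  assumes "0 < \<delta>"
  shows "has_bochner_integral lborel (\<lambda>x::real^2. \<delta> / ((norm x)\<^sup>2 + \<delta>)\<^sup>2)
    (\<integral>x. 1 / (1 + (norm (x::real^2))\<^sup>2)\<^sup>2 \<partial>lborel)"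
proof -
  let ?I = "\<integral>x. 1 / (1 + (norm (x::real^2))\<^sup>2)\<^sup>2 \<partial>lborel"
  have "has_bochner_integral lborel (\<lambda>x::real^2. 1 / (1 + (norm ((1 / sqrt \<delta>) *\<^sub>R x - 0))\<^sup>2)\<^sup>2)
      (?I / \<bar>1 / sqrt \<delta>\<bar> ^ DIM(real^2))"
    using assms by (intro has_bochner_integral_lborel_affine integrable_inverse_1_plus_norm_square) auto
  then have "has_bochner_integral lborel
      (\<lambda>x::real^2. (1 / \<delta>) * (1 / (1 + (norm ((1 / sqrt \<delta>) *\<^sub>R x - 0))\<^sup>2)\<^sup>2))
      ((1 / \<delta>) * (?I / \<bar>1 / sqrt \<delta>\<bar> ^ DIM(real^2)))"
    by (intro has_bochner_integral_mult_right)
  moreover have "(1 / \<delta>) * (1 / (1 + (norm ((1 / sqrt \<delta>) *\<^sub>R x - 0))\<^sup>2)\<^sup>2) = \<delta> / ((norm x)\<^sup>2 + \<delta>)\<^sup>2" for x :: "real^2"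
  proof -
    have "1 + (norm ((1 / sqrt \<delta>) *\<^sub>R x - 0))\<^sup>2 = ((norm x)\<^sup>2 + \<delta>) / \<delta>"
      using assms by (simp add: power_mult_distrib power_divide field_simps)
    then show ?thesis using assms by (simp add: power_divide power2_eq_square)
  qed
  moreover have "(1 / \<delta>) * (?I / \<bar>1 / sqrt \<delta>\<bar> ^ DIM(real^2)) = ?I"
    using assms by (simp add: power_divide)
  ultimately show ?thesis by simp
qed

text \<open>The order of quantifiers is the point: \<open>C\<close> precedes \<open>K\<close>. On
  the bump at scale \<open>k\<close> the derivative of \<open>w\<close> has size at least of order
  \<open>4 ^ k\<close> on an area of order \<open>1 / 4 ^ k\<close>, so each scale adds at least a
  fixed \<open>\<kappa>\<close> to the pairing, while the L1 bound on \<open>f\<close> ignores the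
  number of scales.\<close>

lemma ex_packet_large:
  "\<exists>C. \<forall>K. \<exists>B w f \<eta>. packet B C K w f \<eta>"
proof -
  let ?I = "\<integral>x. 1 / (1 + (norm (x::real^2))\<^sup>2)\<^sup>2 \<partial>lborel"
  \<comment> \<open>The area of the disc belongs to the part of \<open>f\<close> bounded by 6,
    \<open>?I\<close> to the mass of its approximate identity.\<close>
  define C where "C = 6 * measure lborel (cball (0::real^2) 1) + 2 * ?I"
  \<comment> \<open>324 is 8 times 81, halved: the cube of \<open>1 - s \<ge> 1/2\<close> gives 1/8,
    the square of \<open>s + \<delta> \<le> 9 / 4 ^ k\<close> gives 81, and the 2 is the one in
    \<open>2 x\<^sub>1 x\<^sub>2\<close>.\<close>
  define \<kappa> where "\<kappa> = integral\<^sup>L lborel (dyadic_bump 0) / 324"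
  have \<kappa>: "0 < \<kappa>" using integral_dyadic_bump_pos by (simp add: \<kappa>_def)
  have "\<exists>B w f \<eta>. packet B C K w f \<eta>" for K
  proof -
    obtain M :: nat where M: "K / \<kappa> < M" using reals_Archimedean2 by blast
    \<comment> \<open>This is \<open>1 / 4 ^ k\<close> at the finest scale in use,
      \<open>k = M + 1\<close>; on all scales used the regularisation costs only a constant
      factor.\<close>
    define \<delta> :: real where "\<delta> = 1 / 4 ^ (M + 1)"
    have \<delta>: "0 < \<delta>" by (simp add: \<delta>_def)
    let ?m = "\<lambda>s::real. max 0 (1 - s)"
    define \<phi> where "\<phi> = (\<lambda>s. ?m s ^ 3 / (s + \<delta>))"
    define \<phi>' where "\<phi>' = (\<lambda>s. - (3 * ?m s ^ 2) / (s + \<delta>) - ?m s ^ 3 / (s + \<delta>)\<^sup>2)"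
    define \<phi>'' where "\<phi>'' = (\<lambda>s. 6 * ?m s / (s + \<delta>) + 6 * ?m s ^ 2 / (s + \<delta>)\<^sup>2 + 2 * ?m s ^ 3 / (s + \<delta>) ^ 3)"
    have m1: "((\<lambda>s. 1 - s) has_real_derivative - 1) (at s)" for s :: real
      by (auto intro!: derivative_eq_intros)
    have m3: "((\<lambda>s. ?m s ^ 3) has_real_derivative - (3 * ?m s ^ 2)) (at s)" for s
      using DERIV_chain2[OF DERIV_max_power[of 1] m1, of s] by (simp add: numeral_eq_Suc)
    have m2: "((\<lambda>s. ?m s ^ 2) has_real_derivative - (2 * ?m s)) (at s)" for s
      using DERIV_chain2[OF DERIV_max_power[of 0] m1, of s] by (simp add: numeral_eq_Suc)
    have D: "(\<phi> has_real_derivative \<phi>' s) (at s)" "(\<phi>' has_real_derivative \<phi>'' s) (at s)" if "0 \<le> s" for s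
    proof -
      have s: "s + \<delta> \<noteq> 0" using that \<delta> by linarith
      show "(\<phi> has_real_derivative \<phi>' s) (at s)"
        unfolding \<phi>_def \<phi>'_def
        by (rule derivative_eq_intros m3 refl s)+ (use s in \<open>simp add: divide_simps power2_eq_square\<close>)
      have i1: "((\<lambda>s. 1 / (s + \<delta>)) has_real_derivative - (1 / (s + \<delta>)\<^sup>2)) (at s)"
        by (rule derivative_eq_intros refl s)+ (simp add: power2_eq_square)
      have i2: "((\<lambda>s. 1 / (s + \<delta>)\<^sup>2) has_real_derivative - (2 / (s + \<delta>) ^ 3)) (at s)"
        by (rule derivative_eq_intros refl)+ (use s in \<open>simp_all add: divide_simps power2_eq_square power3_eq_cube\<close>)
      have "\<phi>' = (\<lambda>s. - 3 * (?m s ^ 2 * (1 / (s + \<delta>))) - ?m s ^ 3 * (1 / (s + \<delta>)\<^sup>2))"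
        by (simp add: \<phi>'_def fun_eq_iff)
      moreover have "\<phi>'' s = - 3 * (- (2 * ?m s) * (1 / (s + \<delta>)) + - (1 / (s + \<delta>)\<^sup>2) * ?m s ^ 2) -
          (- (3 * ?m s ^ 2) * (1 / (s + \<delta>)\<^sup>2) + - (2 / (s + \<delta>) ^ 3) * ?m s ^ 3)"
        by (simp add: \<phi>''_def)
      ultimately show "(\<phi>' has_real_derivative \<phi>'' s) (at s)"
        using DERIV_diff[OF DERIV_cmult[OF DERIV_mult[OF m2 i1]] DERIV_mult[OF m3 i2], of "- 3"] by simp
    qed
    have cont: "continuous_on {0..} \<phi>'" "continuous_on {0..} \<phi>''"
      unfolding \<phi>'_def \<phi>''_def using \<delta> by (auto intro!: continuous_intros)
    have supp: "\<phi> s = 0" "\<phi>' s = 0" if "1 \<le> s" for s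
      using that by (auto simp: \<phi>_def \<phi>'_def)
    define w where "w = (\<lambda>x::real^2. x $ 1 * \<phi> ((norm x)\<^sup>2))"
    define f where "f = (\<lambda>x::real^2. 2 * (\<phi> ((norm x)\<^sup>2) + (norm x)\<^sup>2 * \<phi>' ((norm x)\<^sup>2)))"
    have sol: "weak_sol w f"
      unfolding w_def f_def using D cont(2) supp by (rule weak_sol_dipole)
    have out: "w x = 0 \<and> f x = 0" if "1 \<le> norm x" for x
      using supp[OF one_le_power[OF that, of 2]] by (simp add: w_def f_def)
    have out': "1 \<le> norm x" if "x \<notin> square" for x
      using that component_le_norm_cart[of x 1] component_le_norm_cart[of x 2]
      by (auto simp: square_def)
    obtain B where B: "\<And>x. \<bar>w x\<bar> \<le> B"
    proof (rule bounded_continuous_bounded_support[of w])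
      show "continuous_on UNIV w" using sol by (simp add: weak_sol_def)
      show "bounded {x. w x \<noteq> 0}"
        by (rule bounded_subset[OF bounded_ball[of 0 1]]) (use out in \<open>force simp: not_less\<close>)
    qed blast
    have f_bound: "\<bar>f x\<bar> \<le> 6 * indicator (cball 0 1) x + 2 * (\<delta> / ((norm x)\<^sup>2 + \<delta>)\<^sup>2)" for x
    proof (cases "norm x \<le> 1")
      case True
      define s where "s = (norm x)\<^sup>2"
      have s: "0 \<le> s" "s \<le> 1" using True by (auto simp: s_def power_le_one)
      then have s\<delta>: "0 < s + \<delta>" using \<delta> by linarith
      define m where "m = 1 - s"
      have m: "0 \<le> m" "m \<le> 1" using s by (auto simp: m_def)
      \<comment> \<open>The terms with \<open>m ^ 3\<close> combine by \<open>1 / (s + \<delta>) - s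
        / (s + \<delta>)\<^sup>2 = \<delta> / (s + \<delta>)\<^sup>2\<close>; differentiating the
        cutoff leaves the bounded rest.\<close>
      have "f x = 2 * (m ^ 3 * (\<delta> / (s + \<delta>)\<^sup>2)) - 6 * (m\<^sup>2 * (s / (s + \<delta>)))"
      proof -
        have "f x = 2 * (m ^ 3 / (s + \<delta>) + s * (- (3 * m ^ 2) / (s + \<delta>) - m ^ 3 / (s + \<delta>)\<^sup>2))"
          using m by (simp add: f_def \<phi>_def \<phi>'_def m_def flip: s_def)
        also have "\<dots> = 2 * (m ^ 3 * (\<delta> / (s + \<delta>)\<^sup>2)) - 6 * (m\<^sup>2 * (s / (s + \<delta>)))"
          using s\<delta> by (simp add: divide_simps power2_eq_square) (simp add: algebra_simps)
        finally show ?thesis .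
      qed
      moreover have "0 \<le> m ^ 3 * (\<delta> / (s + \<delta>)\<^sup>2)" "m ^ 3 * (\<delta> / (s + \<delta>)\<^sup>2) \<le> 1 * (\<delta> / (s + \<delta>)\<^sup>2)"
        using m \<delta> mult_right_mono[OF power_le_one[OF m, of 3], of "\<delta> / (s + \<delta>)\<^sup>2"] by simp_all
      moreover have "0 \<le> m\<^sup>2 * (s / (s + \<delta>))" "m\<^sup>2 * (s / (s + \<delta>)) \<le> 1"
        using m s \<delta> mult_le_one[OF power_le_one[OF m, of 2], of "s / (s + \<delta>)"] by simp_all
      ultimately show ?thesis using True by (auto simp flip: s_def)
    next
      case False
      then show ?thesis using out[of x] \<delta> by simp
    qed
    have f_int: "(\<integral>x. \<bar>f x\<bar> \<partial>lborel) \<le> C"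
    proof -
      have "has_bochner_integral lborel (\<lambda>x::real^2. 6 * indicator (cball 0 1) x + 2 * (\<delta> / ((norm x)\<^sup>2 + \<delta>)\<^sup>2)) C"
        unfolding C_def using emeasure_lborel_cball_finite[of "0::real^2" 1]
        by (intro has_bochner_integral_add has_bochner_integral_mult_right has_bochner_integral_real_indicator
            integral_inverse_norm_square_scaled \<delta>) auto
      then have "(\<integral>x. \<bar>f x\<bar> \<partial>lborel) \<le> (\<integral>x. 6 * indicator (cball (0::real^2) 1) x + 2 * (\<delta> / ((norm x)\<^sup>2 + \<delta>)\<^sup>2) \<partial>lborel)"
        using sol by (intro integral_mono f_bound) (auto simp only: has_bochner_integral_iff weak_sol_def intro: integrable_abs)
      also have "\<dots> = C"
        by (rule has_bochner_integral_integral_eq) fact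
      finally show ?thesis .
    qed
    \<comment> \<open>These are \<open>M\<close> scales. They start at 2 because the bumps then lie
      in \<open>s \<le> 1/2\<close>, well inside the cutoff.\<close>
    define \<eta> where "\<eta> = (\<lambda>x. \<Sum>k\<in>{2..M+1}. dyadic_bump k x)"
    have \<eta>: "test_function \<eta>"
      unfolding \<eta>_def by (intro test_function_sum test_function_dyadic_bump) auto
    have disjoint: "dyadic_bump l x = 0" if "dyadic_bump k x \<noteq> 0" "k \<noteq> l" for k l x
    proof -
      have False if "dyadic_bump k x \<noteq> 0" "dyadic_bump l x \<noteq> 0" "k < l" for k l
      proof -
        \<comment> \<open>The next scale already doubles the coordinate:
          \<open>2 ^ k * x $ 1 > 1\<close> forces \<open>2 ^ l * x $ 1 > 2\<close>.\<close>
        have "2 ^ Suc k \<le> (2::real) ^ l" using that(3) by (intro power_increasing) auto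
        moreover have "0 < x $ 1"
          using dyadic_bump_nonzero(1)[OF that(1)] by (smt (verit) mult_nonneg_nonpos zero_le_power)
        ultimately have "2 ^ Suc k * x $ 1 \<le> 2 ^ l * x $ 1" by (intro mult_right_mono) auto
        with dyadic_bump_nonzero[OF that(1)] dyadic_bump_nonzero[OF that(2)] show False by simp
      qed
      with that show ?thesis by (meson nat_neq_iff)
    qed
    have \<eta>_le: "\<bar>\<eta> x\<bar> \<le> 1" for x
      unfolding \<eta>_def
      by (rule abs_sum_le_if_disjoint) (use disjoint dyadic_bump_bounds in auto)
    have scale: "\<kappa> \<le> (\<integral>x. w x * partial e2 (dyadic_bump k) x \<partial>lborel)" if k: "k \<in> {2..M+1}" for k
    proof -
      let ?g = "\<lambda>x. - (2 * (x $ 1 * x $ 2) * \<phi>' ((norm x)\<^sup>2)) * dyadic_bump k x"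
      \<comment> \<open>On integration the factor \<open>4 ^ k\<close> cancels the decay of the
        bump's mass, so the resulting bound is the same at every scale.\<close>
      have "4 ^ k / 324 * dyadic_bump k x \<le> ?g x" for x
      proof (cases "dyadic_bump k x = 0")
        case False
        define u where "u = 2 ^ k * x $ 1"
        define v where "v = 2 ^ k * x $ 2"
        have uv: "1 < u" "u < 2" "1 < v" "v < 2"
          using dyadic_bump_nonzero[OF False] by (auto simp: u_def v_def)
        define s where "s = (norm x)\<^sup>2"
        define T :: real where "T = 4 ^ k"
        \<comment> \<open>Together with \<open>T * s < 8\<close> below, \<open>16 \<le> T\<close>
          yields \<open>s \<le> 1/2\<close>, and \<open>T * \<delta> \<le> 1\<close> raises the 8 to
          the 9 in \<open>T * (s + \<delta>) \<le> 9\<close>.\<close>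
        have T: "0 < T" "16 \<le> T" "T * \<delta> \<le> 1"
        proof -
          have "(4::real) ^ 2 \<le> 4 ^ k" using k by (intro power_increasing) auto
          then show "16 \<le> T" by (simp add: T_def)
          have "(4::real) ^ k \<le> 4 ^ (M + 1)" using k by (intro power_increasing) auto
          then show "T * \<delta> \<le> 1" by (simp add: T_def \<delta>_def)
        qed (simp add: T_def)
        have TT: "2 ^ k * 2 ^ k = T"
          by (simp add: T_def flip: power_mult_distrib)
        have Ts: "T * s = u\<^sup>2 + v\<^sup>2"
          unfolding s_def norm_square_real_2 u_def v_def TT[symmetric]
          by (simp add: power2_eq_square algebra_simps)
        have "u\<^sup>2 < 4" "v\<^sup>2 < 4"
          using uv power_strict_mono[of u 2 2] power_strict_mono[of v 2 2] by auto
        with Ts have Ts8: "T * s < 8" by simp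
        have "T * s \<le> T * (1 / 2)" using Ts8 T(2) by linarith
        then have s: "0 \<le> s" "s \<le> 1/2"
          using T(1) mult_le_cancel_left_pos[of T s "1/2"] by (auto simp: s_def)
        have "(1/2) ^ 3 \<le> ?m s ^ 3" using s by (intro power_mono) auto
        then have m: "1 / 8 \<le> ?m s ^ 3" by (simp add: power3_eq_cube)
        have s\<delta>: "0 < s + \<delta>" "T * (s + \<delta>) \<le> 9" using s \<delta> Ts8 T by (auto simp: algebra_simps)
        have "(T * (s + \<delta>))\<^sup>2 \<le> 81"
          using power_mono[OF s\<delta>(2), of 2] T s\<delta> by simp
        then have "T\<^sup>2 / 81 \<le> 1 / (s + \<delta>)\<^sup>2"
          using s\<delta> by (simp add: divide_simps power_mult_distrib)
        then have "1 / 8 * (T\<^sup>2 / 81) \<le> ?m s ^ 3 * (1 / (s + \<delta>)\<^sup>2)"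
          using m by (intro mult_mono) auto
        also have "\<dots> \<le> - \<phi>' s"
          using s\<delta> by (simp add: \<phi>'_def)
        finally have a: "T\<^sup>2 / 648 \<le> - \<phi>' s" by simp
        have "1 \<le> u * v" using uv mult_mono[of 1 u 1 v] by simp
        also have "u * v = T * (x $ 1 * x $ 2)"
          unfolding u_def v_def TT[symmetric] by simp
        finally have b: "1 / T \<le> x $ 1 * x $ 2"
          using T by (simp add: divide_simps mult.commute)
        have "2 * (1 / T) * (T\<^sup>2 / 648) \<le> 2 * (x $ 1 * x $ 2) * - \<phi>' s"
          using a b T by (intro mult_mono) (auto intro: order_trans[OF _ b])
        then have "T / 324 \<le> - (2 * (x $ 1 * x $ 2) * \<phi>' s)"
          using T by (simp add: power2_eq_square)
        then show ?thesis
          unfolding s_def T_def by (intro mult_right_mono dyadic_bump_bounds)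
      qed simp
      moreover have "continuous_on UNIV (\<lambda>x::real^2. - (2 * (x $ 1 * x $ 2) * \<phi>' ((norm x)\<^sup>2)))"
        by (intro continuous_intros continuous_real_comp cont)
      then have "integrable lborel ?g"
        by (intro integrable_continuous_times_test test_function_dyadic_bump)
      ultimately have "(\<integral>x. 4 ^ k / 324 * dyadic_bump k x \<partial>lborel) \<le> integral\<^sup>L lborel ?g"
        using integrable_dyadic_bump by (intro integral_mono) auto
      also have "integral\<^sup>L lborel ?g = (\<integral>x. w x * partial e2 (dyadic_bump k) x \<partial>lborel)"
        unfolding w_def using integral_dipole_partial[OF D(1) cont(1) test_function_dyadic_bump] by simp
      finally show ?thesis
        by (simp add: \<kappa>_def integral_dyadic_bump[of k])
    qed
    have pairing: "K \<le> (\<integral>x. w x * partial e2 \<eta> x \<partial>lborel)"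
    proof -
      have cw: "continuous_on UNIV w" using sol by (simp add: weak_sol_def)
      have "K \<le> M * \<kappa>" using M \<kappa> by (simp add: divide_less_eq)
      also have "\<dots> = (\<Sum>k\<in>{2..M+1}. \<kappa>)" by simp
      also have "\<dots> \<le> (\<Sum>k\<in>{2..M+1}. \<integral>x. w x * partial e2 (dyadic_bump k) x \<partial>lborel)"
        by (intro sum_mono scale)
      also have "\<dots> = (\<integral>x. (\<Sum>k\<in>{2..M+1}. w x * partial e2 (dyadic_bump k) x) \<partial>lborel)"
        by (intro Bochner_Integration.integral_sum[symmetric] integrable_continuous_times_test cw
            test_function_partial test_function_dyadic_bump e2_Basis)
      also have "\<dots> = (\<integral>x. w x * partial e2 \<eta> x \<partial>lborel)"
        unfolding \<eta>_def partial_sum[OF test_function_dyadic_bump] sum_distrib_left ..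
      finally show ?thesis .
    qed
    have \<eta>_out: "\<eta> x = 0" if "x \<notin> square" for x
    proof -
      have "dyadic_bump k x = 0" if k: "k \<in> {2..M+1}" for k
      proof (rule ccontr)
        assume nz: "dyadic_bump k x \<noteq> 0"
        have "(2::real) ^ 2 \<le> 2 ^ k" using k by (intro power_increasing) auto
        then have k4: "(4::real) \<le> 2 ^ k" by simp
        have "\<bar>t\<bar> < 1" if "1 < 2 ^ k * t" "2 ^ k * t < 2" for t :: real
        proof -
          have "0 < t" using that(1) by (smt (verit) mult_nonneg_nonpos zero_le_power)
          moreover have "4 * t \<le> 2 ^ k * t" using k4 \<open>0 < t\<close> by (intro mult_right_mono) auto
          ultimately show ?thesis using that(2) by linarith
        qed
        with dyadic_bump_nonzero[OF nz] \<open>x \<notin> square\<close> show False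
          by (auto simp: square_def)
      qed
      then show ?thesis by (simp add: \<eta>_def)
    qed
    show ?thesis
      unfolding packet_def
      using sol \<eta> out[OF out'] \<eta>_out B f_int \<eta>_le pairing by blast
  qed
  then show ?thesis by blast
qed


section \<open>Tiling, shrinking and superposition of packets\<close>

lemma open_square: "open square"
proof -
  have "open {x::real^2. \<bar>x $ 1\<bar> < 1}" "open {x::real^2. \<bar>x $ 2\<bar> < 1}"
    by (intro open_Collect_less continuous_intros)+
  then show ?thesis
    unfolding square_def by (rule open_Collect_conj)
qed

text \<open>For \<open>j \<noteq> i\<close>, \<open>\<eta> j\<close> vanishes on the open set
  \<open>U i\<close>, hence so does its derivative, and outside \<open>U i\<close> the factor
  \<open>w i\<close> is zero. Vanishing at a single point would say nothing about the derivative,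
  hence the open sets.\<close>

lemma sum_times_partial_sum_disjoint:
  fixes w \<eta> :: "'i \<Rightarrow> 'a::euclidean_space \<Rightarrow> real"
  assumes "finite I" and \<eta>: "\<And>i. i \<in> I \<Longrightarrow> test_function (\<eta> i)"
    and U: "\<And>i. i \<in> I \<Longrightarrow> open (U i)"
    and w: "\<And>i x. i \<in> I \<Longrightarrow> x \<notin> U i \<Longrightarrow> w i x = 0"
    and disj: "\<And>i j x. i \<in> I \<Longrightarrow> j \<in> I \<Longrightarrow> i \<noteq> j \<Longrightarrow> x \<in> U i \<Longrightarrow> \<eta> j x = 0"
  shows "(\<Sum>i\<in>I. w i x) * partial v (\<lambda>x. \<Sum>i\<in>I. \<eta> i x) x = (\<Sum>i\<in>I. w i x * partial v (\<eta> i) x)"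
proof -
  have "w i x * (\<Sum>j\<in>I. partial v (\<eta> j) x) = w i x * partial v (\<eta> i) x" if i: "i \<in> I" for i
  proof (cases "w i x = 0")
    case False
    then have "x \<in> U i" using w i by blast
    then have "partial v (\<eta> j) x = 0" if "j \<in> I" "j \<noteq> i" for j
      by (rule partial_eq_0_if_zero_on_open[OF U[OF i]]) (use disj i that in blast)
    then have "(\<Sum>j\<in>I. partial v (\<eta> j) x) = (\<Sum>j\<in>{i}. partial v (\<eta> j) x)"
      using i assms(1) by (intro sum.mono_neutral_right) auto
    then show ?thesis by simp
  qed simp
  moreover have "partial v (\<lambda>x. \<Sum>i\<in>I. \<eta> i x) x = (\<Sum>j\<in>I. partial v (\<eta> j) x)"
    using \<eta> by (rule partial_sum)
  ultimately show ?thesis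
    by (simp only: sum_distrib_right cong: sum.cong)
qed

text \<open>The Jacobian contributes \<open>1 / c\<^sup>2\<close> and the chain rule
  \<open>c\<close>.\<close>

lemma integral_affine_pairing:
  fixes w :: "real^2 \<Rightarrow> real"
  assumes "continuous_on UNIV w" "test_function \<eta>" "0 < c"
  shows "(\<integral>x. w (c *\<^sub>R x - p) * partial e2 (\<lambda>x. \<eta> (c *\<^sub>R x - p)) x \<partial>lborel) =
    (\<integral>x. w x * partial e2 \<eta> x \<partial>lborel) / c"
proof -
  have "integrable lborel (\<lambda>x. w x * partial e2 \<eta> x)"
    using assms by (intro integrable_continuous_times_test test_function_partial e2_Basis)
  from integral_lborel_affine[OF this, of c p] assms(3)
  have "(\<integral>x. w (c *\<^sub>R x - p) * partial e2 \<eta> (c *\<^sub>R x - p) \<partial>lborel) =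
      (\<integral>x. w x * partial e2 \<eta> x \<partial>lborel) / c\<^sup>2"
    by simp
  moreover have "partial e2 (\<lambda>x. \<eta> (c *\<^sub>R x - p)) x = c * partial e2 \<eta> (c *\<^sub>R x - p)" for x
    using assms(2) by (intro partial_affine test_function_differentiable)
  ultimately show ?thesis
    using assms(3) by (simp add: mult.left_commute[of _ c] power2_eq_square)
qed

text \<open>Dilation by \<open>N\<close> with amplitude \<open>1 / N\<close> leaves the size of
  gradients and of \<open>f\<close> unchanged; each of the \<open>N\<^sup>2\<close> tiles carries
  the fraction \<open>1 / N\<^sup>2\<close> of the L1 norm and of the pairing.\<close>

lemma packet_tile:
  fixes N :: nat
  assumes packet: "packet B C K w f \<eta>" and N: "0 < N"
  shows "\<exists>w' f' \<eta>'. packet (B / N) C K w' f' \<eta>'"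
proof -
  have sol: "weak_sol w f" and \<eta>: "test_function \<eta>"
    and out: "\<And>x. x \<notin> square \<Longrightarrow> w x = 0" "\<And>x. x \<notin> square \<Longrightarrow> f x = 0" "\<And>x. x \<notin> square \<Longrightarrow> \<eta> x = 0"
    and B: "\<And>x. \<bar>w x\<bar> \<le> B" and C: "(\<integral>x. \<bar>f x\<bar> \<partial>lborel) \<le> C"
    and \<eta>1: "\<And>x. \<bar>\<eta> x\<bar> \<le> 1" and K: "K \<le> (\<integral>x. w x * partial e2 \<eta> x \<partial>lborel)"
    using packet by (auto simp: packet_def)
  have cont: "continuous_on UNIV w" and f_int: "integrable lborel f"
    using sol by (auto simp: weak_sol_def)
  define I where "I = {..<N} \<times> {..<N}"
  \<comment> \<open>The tile of \<open>(i, j)\<close> has half-width \<open>1 / N\<close> and centre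
    \<open>p (i, j) / N\<close>; the numbers \<open>(2 i + 1 - N) / N\<close> with
    \<open>i < N\<close> are the midpoints of \<open>N\<close> equal parts of (-1, 1).\<close>
  define p :: "nat \<times> nat \<Rightarrow> real^2"
    where "p = (\<lambda>(i, j). vector [2 * real i + 1 - N, 2 * real j + 1 - N])"
  define T where "T = (\<lambda>i x. real N *\<^sub>R x - p i)"
  have I: "finite I" "card I = N * N" by (auto simp: I_def)
  have disj: "i = j" if "T i x \<in> square" "T j x \<in> square" for i j x
    using that by (cases i; cases j) (auto simp: T_def p_def square_def abs_less_iff)
  have inside: "x \<in> square" if i: "i \<in> I" and "T i x \<in> square" for i x
  proof -
    have "\<bar>t\<bar> < 1" if "k < N" "\<bar>N * t - (2 * real k + 1 - N)\<bar> < 1" for k and t :: real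
    proof -
      have "real k + 1 \<le> N" using that(1) by simp
      then have "real N * t < real N * 1" "real N * (- 1) < real N * t" 
        using that(2) unfolding abs_less_iff by linarith+
      then have "t < 1" "- 1 < t"
        using N by (simp_all only: mult_less_cancel_left_pos of_nat_0_less_iff)
      then show ?thesis by (simp add: abs_less_iff)
    qed
    with that show ?thesis
      by (cases i) (auto simp: I_def T_def p_def square_def)
  qed
  define w' where "w' = (\<lambda>x. \<Sum>i\<in>I. 1 / N * w (real N *\<^sub>R x - p i))"
  \<comment> \<open>The factor \<open>1 / N * real N\<close> is the \<open>a * c\<close> of
    \<open>weak_sol_affine\<close>; its value is 1.\<close>
  define f' where "f' = (\<lambda>x. \<Sum>i\<in>I. 1 / N * real N * f (real N *\<^sub>R x - p i))"
  define \<eta>' where "\<eta>' = (\<lambda>x. \<Sum>i\<in>I. \<eta> (real N *\<^sub>R x - p i))"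
  have "weak_sol w' f'"
    unfolding w'_def f'_def using N by (intro weak_sol_sum weak_sol_affine sol) auto
  moreover have t\<eta>: "test_function (\<lambda>x. \<eta> (real N *\<^sub>R x - p i))" for i
    using N \<eta> by (intro test_function_affine) auto
  then have "test_function \<eta>'"
    unfolding \<eta>'_def using I by (intro test_function_sum) auto
  moreover have "w' x = 0" "f' x = 0" "\<eta>' x = 0" if "x \<notin> square" for x
  proof -
    have "real N *\<^sub>R x - p i \<notin> square" if "i \<in> I" for i
      using inside[OF that, of x] \<open>x \<notin> square\<close> unfolding T_def by blast
    then show "w' x = 0" "f' x = 0" "\<eta>' x = 0"
      unfolding w'_def f'_def \<eta>'_def using out by (auto intro!: sum.neutral)
  qed
  moreover have "\<bar>w' x\<bar> \<le> B / N" for x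
    unfolding w'_def
  proof (rule abs_sum_le_if_disjoint[OF I(1)])
    show "0 \<le> B / N" using B[of 0] by simp
    show "\<bar>1 / N * w (real N *\<^sub>R x - p i)\<bar> \<le> B / N" for i
      using B N by (simp add: abs_mult divide_right_mono)
    show "1 / N * w (real N *\<^sub>R x - p j) = 0" if "i \<noteq> j" "1 / N * w (real N *\<^sub>R x - p i) \<noteq> 0" for i j
      using that disj[of i x j] out(1) unfolding T_def by fastforce
  qed
  moreover have "\<bar>\<eta>' x\<bar> \<le> 1" for x
    unfolding \<eta>'_def
  proof (rule abs_sum_le_if_disjoint[OF I(1)])
    show "\<eta> (real N *\<^sub>R x - p j) = 0" if "i \<noteq> j" "\<eta> (real N *\<^sub>R x - p i) \<noteq> 0" for i j
      using that disj[of i x j] out(3) unfolding T_def by blast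
  qed (use \<eta>1 in auto)
  moreover have "(\<integral>x. \<bar>f' x\<bar> \<partial>lborel) \<le> C"
  proof -
    have fi: "integrable lborel (\<lambda>x. \<bar>f (real N *\<^sub>R x - p i)\<bar>)"
        "(\<integral>x. \<bar>f (real N *\<^sub>R x - p i)\<bar> \<partial>lborel) = (\<integral>x. \<bar>f x\<bar> \<partial>lborel) / (real N)\<^sup>2" for i
      using integrable_lborel_affine[of "\<lambda>x. \<bar>f x\<bar>" "real N" "p i"]
        integral_lborel_affine[of "\<lambda>x. \<bar>f x\<bar>" "real N" "p i"] f_int N by simp_all
    have "\<bar>f' x\<bar> \<le> (\<Sum>i\<in>I. \<bar>f (real N *\<^sub>R x - p i)\<bar>)" for x
      unfolding f'_def using N by (simp add: sum_abs)
    then have "(\<integral>x. \<bar>f' x\<bar> \<partial>lborel) \<le> (\<integral>x. (\<Sum>i\<in>I. \<bar>f (real N *\<^sub>R x - p i)\<bar>) \<partial>lborel)"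
      using fi by (intro integral_mono' Bochner_Integration.integrable_sum) (auto intro: sum_nonneg)
    also have "\<dots> = (\<integral>x. \<bar>f x\<bar> \<partial>lborel)"
      using fi N I by (simp add: power2_eq_square)
    finally show ?thesis using C by simp
  qed
  moreover have "K \<le> (\<integral>x. w' x * partial e2 \<eta>' x \<partial>lborel)"
  proof -
    define P where "P = (\<integral>x. w x * partial e2 \<eta> x \<partial>lborel)"
    have "w' x * partial e2 \<eta>' x =
        (\<Sum>i\<in>I. 1 / N * w (real N *\<^sub>R x - p i) * partial e2 (\<lambda>x. \<eta> (real N *\<^sub>R x - p i)) x)" for x
      unfolding w'_def \<eta>'_def
    proof (rule sum_times_partial_sum_disjoint[OF I(1) t\<eta>, where U = "\<lambda>i. T i -` square"])
      show "open (T i -` square)" for i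
        unfolding T_def by (intro open_vimage open_square continuous_intros)
      show "1 / real N * w (real N *\<^sub>R x - p i) = 0" if "x \<notin> T i -` square" for i x
        using out(1) that by (simp add: T_def)
      show "\<eta> (real N *\<^sub>R x - p j) = 0" if "i \<noteq> j" "x \<in> T i -` square" for i j x
        using out(3) disj[of i x j] that by (auto simp: T_def)
    qed
    then have "(\<integral>x. w' x * partial e2 \<eta>' x \<partial>lborel) = (\<integral>x. (\<Sum>i\<in>I.
        1 / N * w (real N *\<^sub>R x - p i) * partial e2 (\<lambda>x. \<eta> (real N *\<^sub>R x - p i)) x) \<partial>lborel)"
      by simp
    also have "\<dots> = (\<Sum>i\<in>I. \<integral>x.
        1 / N * w (real N *\<^sub>R x - p i) * partial e2 (\<lambda>x. \<eta> (real N *\<^sub>R x - p i)) x \<partial>lborel)"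
      by (intro Bochner_Integration.integral_sum integrable_continuous_times_test test_function_partial
          t\<eta> e2_Basis continuous_intros continuous_on_compose2[OF cont]) auto
    also have "\<dots> = (\<Sum>i\<in>I. 1 / N * (P / N))"
      using integral_affine_pairing[OF cont \<eta>, of "real N"] N by (simp add: mult.assoc P_def)
    also have "\<dots> = P" using N I by simp
    finally show ?thesis using K by (simp add: P_def)
  qed
  ultimately have "packet (B / N) C K w' f' \<eta>'"
    unfolding packet_def by blast
  then show ?thesis by blast
qed

text \<open>The supremum bound \<open>B\<close> of a large packet may depend on \<open>K\<close>.
  Tiling with \<open>N > B / \<epsilon>\<close> makes it small, while \<open>C\<close> and
  \<open>K\<close> stay as they are.\<close>

lemma ex_packet_small:
  "\<exists>C. \<forall>K \<epsilon>. 0 < \<epsilon> \<longrightarrow> (\<exists>w f \<eta>. packet \<epsilon> C K w f \<eta>)"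
proof -
  obtain C where C: "\<And>K. \<exists>B w f \<eta>. packet B C K w f \<eta>"
    using ex_packet_large by blast
  have "\<exists>w f \<eta>. packet \<epsilon> C K w f \<eta>" if \<epsilon>: "0 < \<epsilon>" for K \<epsilon>
  proof -
    obtain B w f \<eta> where "packet B C K w f \<eta>" using C by blast
    moreover obtain N :: nat where N: "max 0 (B / \<epsilon>) < N" using reals_Archimedean2 by blast
    ultimately obtain w' f' \<eta>' where "packet (B / N) C K w' f' \<eta>'"
      using packet_tile[of B C K w f \<eta> N] by auto
    moreover have "B / N \<le> \<epsilon>" using N \<epsilon> by (simp add: field_simps)
    ultimately have "packet \<epsilon> C K w' f' \<eta>'"
      unfolding packet_def by (meson order_trans)
    then show ?thesis by blast
  qed
  then show ?thesis by blast
qed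

text \<open>Shrinking packet \<open>n\<close> by \<open>c n\<close> at fixed amplitude divides both
  the L1 norm of its right-hand side and its pairing by \<open>c n\<close>. The first makes the
  series for \<open>F\<close> converge in L1; the second is offset by requiring
  \<open>n * c n\<close> beforehand, which is possible because \<open>C\<close> does not depend on
  \<open>K\<close>.\<close>

lemma ex_singular_weak_sol:
  assumes \<epsilon>: "0 < \<epsilon>"
  shows "\<exists>W F \<eta>. weak_sol W F \<and> (\<forall>x. x \<notin> square \<longrightarrow> W x = 0 \<and> F x = 0) \<and> (\<forall>x. \<bar>W x\<bar> \<le> \<epsilon>) \<and>
    (\<forall>n::nat. test_function (\<eta> n) \<and> (\<forall>x. \<bar>\<eta> n x\<bar> \<le> 1) \<and> (\<forall>x. x \<notin> square \<longrightarrow> \<eta> n x = 0) \<and>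
      real n \<le> (\<integral>x. W x * partial e2 (\<eta> n) x \<partial>lborel))"
proof -
  obtain C where C: "\<And>K \<epsilon>. 0 < \<epsilon> \<Longrightarrow> \<exists>w f \<eta>. packet \<epsilon> C K w f \<eta>"
    using ex_packet_small by blast
  \<comment> \<open>Doubling from one \<open>n\<close> to the next separates the copies, and
    \<open>c n \<ge> 4\<close> keeps them inside \<open>square\<close>.\<close>
  define c :: "nat \<Rightarrow> real" where "c n = 2 ^ (n + 2)" for n
  have c: "0 < c n" "4 \<le> c n" for n by (simp_all add: c_def)
  define e :: "nat \<Rightarrow> real" where "e n = \<epsilon> * (1 / 2) ^ Suc n" for n
  have e: "0 < e n" for n using \<epsilon> by (simp add: e_def)
  have e_sums: "e sums \<epsilon>"
    unfolding e_def using sums_mult[OF power_half_series, of \<epsilon>] by simp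
  have "\<forall>n. \<exists>w f \<eta>. packet (e n) C (n * c n) w f \<eta>"
    using C e by blast
  then obtain w f \<eta> where packet: "\<And>n. packet (e n) C (n * c n) (w n) (f n) (\<eta> n)"
    by metis
  have sol: "weak_sol (w n) (f n)" and \<eta>: "test_function (\<eta> n)"
    and out: "x \<notin> square \<Longrightarrow> w n x = 0" "x \<notin> square \<Longrightarrow> f n x = 0" "x \<notin> square \<Longrightarrow> \<eta> n x = 0"
    and B: "\<bar>w n x\<bar> \<le> e n" and fC: "(\<integral>x. \<bar>f n x\<bar> \<partial>lborel) \<le> C"
    and \<eta>1: "\<bar>\<eta> n x\<bar> \<le> 1" and K: "n * c n \<le> (\<integral>x. w n x * partial e2 (\<eta> n) x \<partial>lborel)" for n x
    using packet[of n] by (simp_all add: packet_def)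
  \<comment> \<open>With this offset copy \<open>n\<close> occupies part of the strip
    \<open>2 / c n < x $ 1 < 4 / c n\<close>: disjoint dyadic strips that approach the axis
    \<open>x $ 1 = 0\<close>.\<close>
  define p :: "real^2" where "p = vector [3, 0]"
  define T where "T = (\<lambda>n x. c n *\<^sub>R x - p)"
  have T: "2 < c n * x $ 1" "c n * x $ 1 < 4" "\<bar>c n * x $ 2\<bar> < 1" if "T n x \<in> square" for n x
    using that by (auto simp: T_def p_def square_def abs_less_iff)
  have disj: "n = m" if "T n x \<in> square" "T m x \<in> square" for n m x
  proof -
    have False if "n < m" "T n x \<in> square" "T m x \<in> square" for n m
    proof -
      have "2 * c n \<le> c m"
        unfolding c_def using that(1) power_increasing[of "n + 3" "m + 2" "2::real"] by (simp add: power_add)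
      moreover have "0 < x $ 1" using T(1)[OF that(2)] c(1)[of n]
        by (smt (verit) mult_nonneg_nonpos)
      ultimately have "2 * c n * x $ 1 \<le> c m * x $ 1" by (intro mult_right_mono) auto
      with T(1)[OF that(2)] T(2)[OF that(3)] show False by simp
    qed
    with that show ?thesis by (meson nat_neq_iff)
  qed
  have inside: "x \<in> square" if "T n x \<in> square" for n x
  proof -
    have abs_c: "c n * \<bar>t\<bar> = \<bar>c n * t\<bar>" for t
      using c(1)[of n] by (simp add: abs_mult)
    have "c n * \<bar>x $ 1\<bar> < c n * 1" "c n * \<bar>x $ 2\<bar> < c n * 1"
      unfolding abs_c using T[OF that] c(2)[of n] unfolding abs_less_iff by (intro conjI; linarith)+
    then show ?thesis using c(1)[of n] by (simp only: square_def mult_less_cancel_left_pos mem_Collect_eq)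
  qed
  define w' where "w' = (\<lambda>n x. 1 * w n (c n *\<^sub>R x - p))"
  define f' where "f' = (\<lambda>n x. 1 * c n * f n (c n *\<^sub>R x - p))"
  define \<eta>' where "\<eta>' = (\<lambda>n x. \<eta> n (c n *\<^sub>R x - p))"
  define W where "W = (\<lambda>x. \<Sum>n. w' n x)"
  define F where "F = (\<lambda>x. \<Sum>n. f' n x)"
  have out': "T n x \<notin> square \<Longrightarrow> w' n x = 0" "T n x \<notin> square \<Longrightarrow> f' n x = 0"
    "T n x \<notin> square \<Longrightarrow> \<eta>' n x = 0" for n x
    by (auto simp: w'_def f'_def \<eta>'_def T_def out)
  have sol': "weak_sol (w' n) (f' n)" for n
    unfolding w'_def f'_def by (intro weak_sol_affine sol c)
  have w'_le: "\<bar>w' n x\<bar> \<le> e n" for n x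
    using B by (simp add: w'_def)
  have "weak_sol W F"
    unfolding W_def F_def
  proof (rule weak_sol_suminf[OF sol' w'_le sums_summable[OF e_sums]])
    have f_int: "integrable lborel (f n)" for n
      using sol[of n] by (simp add: weak_sol_def)
    have f'_le: "(\<integral>x. \<bar>f' n x\<bar> \<partial>lborel) \<le> C / 4 * (1 / 2) ^ n" for n
    proof -
      have "(\<integral>x. \<bar>f' n x\<bar> \<partial>lborel) = c n * (\<integral>x. \<bar>f n (c n *\<^sub>R x - p)\<bar> \<partial>lborel)"
        unfolding f'_def using c(1)[of n] by (simp add: abs_mult)
      also have "\<dots> = (\<integral>x. \<bar>f n x\<bar> \<partial>lborel) / c n"
        using integral_lborel_affine[of "\<lambda>x. \<bar>f n x\<bar>" "c n" p] f_int[of n] c(1)[of n]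
        by (simp add: power2_eq_square)
      also have "\<dots> \<le> C / c n" using fC c(1)[of n] by (simp add: divide_right_mono)
      also have "\<dots> = C / 4 * (1 / 2) ^ n" by (simp add: c_def power_divide)
      finally show ?thesis .
    qed
    show "summable (\<lambda>n. \<integral>x. \<bar>f' n x\<bar> \<partial>lborel)"
    proof (rule summable_comparison_test'[of "\<lambda>n. C / 4 * (1 / 2) ^ n" 0])
      show "summable (\<lambda>n. C / 4 * (1 / 2::real) ^ n)"
        by (intro summable_mult summable_geometric) simp
      show "norm (\<integral>x. \<bar>f' n x\<bar> \<partial>lborel) \<le> C / 4 * (1 / 2) ^ n" for n
        using f'_le[of n] Bochner_Integration.integral_nonneg[of lborel "\<lambda>x. \<bar>f' n x\<bar>"] by simp
    qed
    show "summable (\<lambda>n. \<bar>f' n x\<bar>)" for x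
    proof (cases "\<exists>m. T m x \<in> square")
      case True
      then obtain m where m: "T m x \<in> square" by blast
      have "f' n x = 0" if "n \<noteq> m" for n
        using that disj[OF _ m] out'(2) by blast
      then show ?thesis
        by (intro summable_finite[of "{m}"]) auto
    next
      case False
      then have "f' n x = 0" for n using out'(2) by blast
      then show ?thesis by simp
    qed
  qed
  moreover have "W x = 0" "F x = 0" if "x \<notin> square" for x
  proof -
    have "w' n x = 0" "f' n x = 0" for n using inside out' that by blast+
    then show "W x = 0" "F x = 0" by (simp_all add: W_def F_def)
  qed
  moreover have "\<bar>W x\<bar> \<le> \<epsilon>" for x
  proof -
    have s: "summable (\<lambda>n. \<bar>w' n x\<bar>)"
      by (rule summable_comparison_test'[OF sums_summable[OF e_sums], of 0]) (use w'_le in simp)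
    have "\<bar>W x\<bar> \<le> (\<Sum>n. \<bar>w' n x\<bar>)" unfolding W_def by (rule summable_rabs[OF s])
    also have "\<dots> \<le> (\<Sum>n. e n)" by (rule suminf_le[OF w'_le s sums_summable[OF e_sums]])
    also have "\<dots> = \<epsilon>" using e_sums by (rule sums_unique[symmetric])
    finally show ?thesis .
  qed
  moreover have t\<eta>': "test_function (\<eta>' n)" for n
    unfolding \<eta>'_def using c(1)[of n] by (intro test_function_affine \<eta>) simp
  moreover have "\<bar>\<eta>' n x\<bar> \<le> 1" for n x
    by (simp add: \<eta>'_def \<eta>1)
  moreover have "\<eta>' n x = 0" if "x \<notin> square" for n x
    using inside out'(3) that by blast
  moreover have "real n \<le> (\<integral>x. W x * partial e2 (\<eta>' n) x \<partial>lborel)" for n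
  proof -
    \<comment> \<open>On the open square of another copy \<open>\<eta>' n\<close> vanishes together
      with its derivative; elsewhere the series for \<open>W\<close> reduces to its term
      \<open>n\<close>.\<close>
    have "W x * partial e2 (\<eta>' n) x = w' n x * partial e2 (\<eta>' n) x" for x
    proof (cases "\<exists>m. m \<noteq> n \<and> T m x \<in> square")
      case True
      then obtain m where m: "m \<noteq> n" "x \<in> T m -` square" by auto
      have "partial e2 (\<eta>' n) x = 0"
      proof (rule partial_eq_0_if_zero_on_open[OF _ m(2)])
        show "open (T m -` square)"
          unfolding T_def by (intro open_vimage open_square continuous_intros)
        show "\<eta>' n y = 0" if "y \<in> T m -` square" for y
          using that m(1) disj[of m y n] out'(3) by auto
      qed
      then show ?thesis by simp
    next
      case False
      then have "W x = (\<Sum>m\<in>{n}. w' m x)"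
        unfolding W_def using out'(1) by (intro suminf_finite) blast+
      then show ?thesis by simp
    qed
    then have "(\<integral>x. W x * partial e2 (\<eta>' n) x \<partial>lborel) = (\<integral>x. w' n x * partial e2 (\<eta>' n) x \<partial>lborel)"
      by (simp only:)
    also have "\<dots> = (\<integral>x. w n x * partial e2 (\<eta> n) x \<partial>lborel) / c n"
      unfolding w'_def \<eta>'_def using sol[of n] \<eta> c(1)[of n]
      by (simp add: weak_sol_def integral_affine_pairing)
    finally show ?thesis using K[of n] c(1)[of n] by (simp add: le_divide_eq)
  qed
  ultimately show ?thesis by blast
qed

section \<open>The Gaussian density and the theorem\<close>

lemma gauss_density2_pos: "0 < gauss_density2 x"
  by (simp add: gauss_density2_def)

lemma gauss_density2_le_1: "gauss_density2 x \<le> 1"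
proof -
  have "inverse (2 * pi) \<le> 1" using pi_gt3 by (simp add: divide_simps)
  then show ?thesis
    unfolding gauss_density2_def by (intro mult_le_one) auto
qed

lemma gauss_density2_DERIV:
  "((\<lambda>t. gauss_density2 (x + t *\<^sub>R e1)) has_real_derivative - x $ 1 * gauss_density2 x) (at 0)"
  "((\<lambda>t. gauss_density2 (x + t *\<^sub>R e2)) has_real_derivative - x $ 2 * gauss_density2 x) (at 0)"
proof -
  let ?\<phi> = "\<lambda>s::real. inverse (2 * pi) * exp (- s / 2)"
  have D: "(?\<phi> has_real_derivative inverse (2 * pi) * (exp (- s / 2) * (- 1 / 2))) (at s)" for s
    by (auto intro!: derivative_eq_intros)
  show "((\<lambda>t. gauss_density2 (x + t *\<^sub>R e1)) has_real_derivative - x $ 1 * gauss_density2 x) (at 0)"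
    using DERIV_radial(1)[OF D, of x] by (simp add: gauss_density2_def field_simps)
  show "((\<lambda>t. gauss_density2 (x + t *\<^sub>R e2)) has_real_derivative - x $ 2 * gauss_density2 x) (at 0)"
    using DERIV_radial(2)[OF D, of x] by (simp add: gauss_density2_def field_simps)
qed

lemma continuous_gauss_density2: "continuous_on S gauss_density2"
  unfolding gauss_density2_def[abs_def] by (intro continuous_intros) auto

text \<open>The inequality \<open>y \<le> exp y\<close> at \<open>y = (1 + s) / 6\<close>, cubed,
  gives \<open>(1 + s) ^ 3 \<le> 216 exp ((1 + s) / 2)\<close>, an exponent matched to the Gaussian.
  Two of the three powers form the majorant; the third absorbs
  \<open>1 + norm x \<le> 2 (1 + s)\<close>, which doubles 216.\<close>

lemma gauss_density2_decay: "(1 + norm x) * gauss_density2 x \<le> 432 * exp (1 / 2) / (1 + (norm x)\<^sup>2)\<^sup>2"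
proof -
  define s where "s = (norm x)\<^sup>2"
  have s: "0 \<le> s" by (simp add: s_def)
  have n: "1 + norm x \<le> 2 * (1 + s)"
    using zero_le_power2[of "norm x - 1 / 4"] by (simp add: s_def power2_diff power_divide)
  have "(1 + s) / 6 \<le> exp ((1 + s) / 6)"
    using exp_ge_add_one_self[of "(1 + s) / 6"] by linarith
  then have "((1 + s) / 6) ^ 3 \<le> exp ((1 + s) / 6) ^ 3"
    using s by (intro power_mono) auto
  also have "\<dots> = exp ((1 + s) / 2)"
    by (simp flip: exp_of_nat_mult)
  also have "\<dots> = exp (1 / 2) * exp (s / 2)"
    by (simp add: add_divide_distrib exp_add)
  finally have "(1 + s) ^ 3 \<le> 216 * exp (1 / 2) * exp (s / 2)"
    by (simp add: power_divide)
  then have e: "(1 + s) ^ 3 * exp (- s / 2) \<le> 216 * exp (1 / 2)"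
    by (simp add: exp_minus field_simps)
  have g: "gauss_density2 x \<le> 1 * exp (- s / 2)"
    unfolding gauss_density2_def s_def using pi_gt3 by (intro mult_right_mono) (auto simp: divide_simps)
  have "(1 + norm x) * gauss_density2 x * (1 + s)\<^sup>2 \<le> 2 * (1 + s) * (1 * exp (- s / 2)) * (1 + s)\<^sup>2"
    using n g s gauss_density2_pos[of x] by (intro mult_right_mono mult_mono) auto
  also have "\<dots> = 2 * ((1 + s) ^ 3 * exp (- s / 2))"
    by (simp add: power2_eq_square power3_eq_cube)
  also have "\<dots> \<le> 432 * exp (1 / 2)" using e by simp
  finally have "(1 + norm x) * gauss_density2 x * (1 + s)\<^sup>2 \<le> 432 * exp (1 / 2)" .
  moreover have "0 < (1 + s)\<^sup>2"
    using s by (intro zero_less_power) linarith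
  ultimately show ?thesis
    unfolding s_def by (simp only: pos_le_divide_eq)
qed

lemma integrable_gauss_density2:
  "integrable lborel gauss_density2" "integrable lborel (\<lambda>x. norm x * gauss_density2 x)"
proof -
  have major: "integrable lborel (\<lambda>x::real^2. 432 * exp (1 / 2) * (1 / (1 + (norm x)\<^sup>2)\<^sup>2))"
    by (intro integrable_mult_right integrable_inverse_1_plus_norm_square)
  have [measurable]: "gauss_density2 \<in> borel_measurable borel"
    by (rule borel_measurable_continuous_onI[OF continuous_gauss_density2])
  have *: "gauss_density2 x \<le> 432 * exp (1 / 2) * (1 / (1 + (norm x)\<^sup>2)\<^sup>2)"
    "norm x * gauss_density2 x \<le> 432 * exp (1 / 2) * (1 / (1 + (norm x)\<^sup>2)\<^sup>2)" for x
  proof -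
    have "gauss_density2 x + norm x * gauss_density2 x \<le> 432 * exp (1 / 2) * (1 / (1 + (norm x)\<^sup>2)\<^sup>2)"
      using gauss_density2_decay[of x] by (simp add: distrib_right)
    moreover have "0 \<le> norm x * gauss_density2 x"
      using gauss_density2_pos[of x] by simp
    ultimately show "gauss_density2 x \<le> 432 * exp (1 / 2) * (1 / (1 + (norm x)\<^sup>2)\<^sup>2)"
      "norm x * gauss_density2 x \<le> 432 * exp (1 / 2) * (1 / (1 + (norm x)\<^sup>2)\<^sup>2)"
      using gauss_density2_pos[of x] by linarith+
  qed
  show "integrable lborel gauss_density2"
    by (rule Bochner_Integration.integrable_bound[OF major])
      (use *(1) gauss_density2_pos in \<open>auto intro!: order_trans[OF *(1)] simp: less_imp_le\<close>)
  show "integrable lborel (\<lambda>x. norm x * gauss_density2 x)"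
    by (rule Bochner_Integration.integrable_bound[OF major])
      (use *(2) gauss_density2_pos in \<open>auto intro!: order_trans[OF *(2)] simp: less_imp_le abs_mult\<close>)
qed

lemma inner_grad_real_2: "y \<bullet> grad \<phi> x = y $ 1 * partial e1 \<phi> x + y $ 2 * partial e2 \<phi> x"
  by (simp add: grad_def Basis_real_2 inner_add_right inner_axis)

text \<open>The gradient of the Gaussian is \<open>- x\<close> times the Gaussian, so the integrand
  is the divergence of \<open>gauss_density2\<close> times \<open>grad \<phi>\<close>.\<close>

lemma integral_gauss_density2_generator:
  assumes \<phi>: "test_function \<phi>"
  shows "has_bochner_integral lborel (\<lambda>x. gauss_density2 x * (laplacian \<phi> x - x \<bullet> grad \<phi> x)) 0"
proof -
  let ?h = "\<lambda>i x. gauss_density2 x * partial i (partial i \<phi>) x - (x \<bullet> i) * gauss_density2 x * partial i \<phi> x"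
  have P: "test_function (partial e1 \<phi>)" "test_function (partial e2 \<phi>)"
    using \<phi> by (auto intro: test_function_partial e1_Basis e2_Basis)
  have P2: "test_function (partial e1 (partial e1 \<phi>))" "test_function (partial e2 (partial e2 \<phi>))"
    using P by (auto intro: test_function_partial e1_Basis e2_Basis)
  note cont = continuous_gauss_density2 P[THEN test_function_continuous] P2[THEN test_function_continuous]
  note D = P[THEN test_function_differentiable, THEN DERIV_along_partial]
  have "integral\<^sup>L lborel (?h e1) = 0"
  proof (rule integral_directional_derivative_eq_0)
    show "bounded {x. gauss_density2 x * partial e1 \<phi> x \<noteq> 0}"
      by (rule bounded_subset[OF test_function_bounded_support[OF P(1)]]) auto
    show "((\<lambda>t. gauss_density2 (x + t *\<^sub>R e1) * partial e1 \<phi> (x + t *\<^sub>R e1)) has_real_derivative ?h e1 x) (at 0)" for x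
      by (rule derivative_eq_intros gauss_density2_DERIV D refl)+ (simp add: inner_axis)
  qed (intro continuous_intros cont)+
  moreover have "integral\<^sup>L lborel (?h e2) = 0"
  proof (rule integral_directional_derivative_eq_0)
    show "bounded {x. gauss_density2 x * partial e2 \<phi> x \<noteq> 0}"
      by (rule bounded_subset[OF test_function_bounded_support[OF P(2)]]) auto
    show "((\<lambda>t. gauss_density2 (x + t *\<^sub>R e2) * partial e2 \<phi> (x + t *\<^sub>R e2)) has_real_derivative ?h e2 x) (at 0)" for x
      by (rule derivative_eq_intros gauss_density2_DERIV D refl)+ (simp add: inner_axis)
  qed (intro continuous_intros cont)+
  moreover have "integrable lborel (?h e1)" "integrable lborel (?h e2)"
    by (intro Bochner_Integration.integrable_diff integrable_continuous_times_test P P2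
        continuous_intros continuous_gauss_density2)+
  ultimately have "has_bochner_integral lborel (\<lambda>x. ?h e1 x + ?h e2 x) 0"
    by (simp add: has_bochner_integral_iff)
  then show ?thesis
    by (simp add: laplacian_real_2 inner_grad_real_2 inner_axis algebra_simps)
qed

lemma integrable_density_bounded:
  fixes g :: "'a::euclidean_space \<Rightarrow> real"
  assumes g: "g \<in> borel_measurable borel" "\<And>x. 0 \<le> g x" "\<And>x. g x \<le> M" and h: "integrable lborel h"
  shows "integrable (density lborel (\<lambda>x. ennreal (g x))) (h :: 'a \<Rightarrow> real)"
proof -
  have [measurable]: "g \<in> borel_measurable borel" "h \<in> borel_measurable borel"
    using g h by auto
  have "integrable lborel (\<lambda>x. g x * h x)"
  proof (rule Bochner_Integration.integrable_bound)
    show "integrable lborel (\<lambda>x. M * h x)" using h by simp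
    have "norm (g x * h x) \<le> norm (M * h x)" for x
      using g(2)[of x] g(3)[of x] by (auto simp: abs_mult intro!: mult_right_mono)
    then show "AE x in lborel. norm (g x * h x) \<le> norm (M * h x)" by (rule AE_I2)
  qed measurable
  then show ?thesis using g by (simp add: integrable_density)
qed

text \<open>After integration by parts only \<open>|\<eta>| \<le> 1\<close> enters. The Gaussian
  part of the density thus has uniformly bounded pairings and cannot offset the unbounded ones of
  \<open>W\<close>.\<close>

lemma integral_gauss_density2_partial_le:
  assumes \<eta>: "test_function \<eta>" "\<And>x. \<bar>\<eta> x\<bar> \<le> 1"
  shows "\<bar>\<integral>x. gauss_density2 x * partial e2 \<eta> x \<partial>lborel\<bar> \<le> (\<integral>x. norm x * gauss_density2 x \<partial>lborel)"
proof -
  have P: "test_function (partial e2 \<eta>)"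
    using \<eta> by (auto intro: test_function_partial e2_Basis)
  let ?a = "\<lambda>x. gauss_density2 x * partial e2 \<eta> x"
  let ?b = "\<lambda>x. x $ 2 * gauss_density2 x * \<eta> x"
  note cont = continuous_gauss_density2 test_function_continuous[OF \<eta>(1)] test_function_continuous[OF P]
  have int: "integrable lborel ?a" "integrable lborel ?b"
    by (intro integrable_continuous_times_test P \<eta> continuous_intros continuous_gauss_density2)+
  have "(\<integral>x. ?a x - ?b x \<partial>lborel) = 0"
  proof (rule integral_directional_derivative_eq_0)
    show "bounded {x. gauss_density2 x * \<eta> x \<noteq> 0}"
      by (rule bounded_subset[OF test_function_bounded_support[OF \<eta>(1)]]) auto
    show "((\<lambda>t. gauss_density2 (x + t *\<^sub>R e2) * \<eta> (x + t *\<^sub>R e2)) has_real_derivative ?a x - ?b x) (at 0)" for x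
      by (rule derivative_eq_intros gauss_density2_DERIV
          DERIV_along_partial[OF test_function_differentiable[OF \<eta>(1)]] refl)+ simp
  qed (intro continuous_intros cont)+
  with int have "\<bar>\<integral>x. ?a x \<partial>lborel\<bar> = \<bar>\<integral>x. ?b x \<partial>lborel\<bar>" by simp
  also have "\<dots> \<le> (\<integral>x. \<bar>?b x\<bar> \<partial>lborel)" by (rule integral_abs_bound)
  also have "\<dots> \<le> (\<integral>x. norm x * gauss_density2 x \<partial>lborel)"
  proof (rule integral_mono)
    show "\<bar>?b x\<bar> \<le> norm x * gauss_density2 x" for x
    proof -
      have "\<bar>?b x\<bar> = \<bar>x $ 2\<bar> * gauss_density2 x * \<bar>\<eta> x\<bar>"
        using gauss_density2_pos[of x] by (simp add: abs_mult)
      also have "\<dots> \<le> norm x * gauss_density2 x * 1"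
        using gauss_density2_pos[of x] \<eta>(2)[of x] component_le_norm_cart[of x 2]
        by (intro mult_mono) auto
      finally show ?thesis by simp
    qed
  qed (use int integrable_gauss_density2 in auto)
  finally show ?thesis .
qed

text \<open>An integrable weak derivative \<open>g\<close> of the localised density would bound
  every pairing by the integral of \<open>|g|\<close>, since
  \<open>|\<eta> n| \<le> 1\<close>.\<close>

lemma not_W11_loc_if_unbounded_pairing:
  fixes \<rho> :: "real^2 \<Rightarrow> real"
  assumes \<rho>: "\<rho> \<in> borel_measurable borel"
    and \<eta>: "\<And>n. test_function (\<eta> n)" "\<And>n x. \<bar>\<eta> n x\<bar> \<le> 1" "\<And>n x. x \<notin> square \<Longrightarrow> \<eta> n x = 0"
    and pairing: "\<And>A. \<exists>n. A < \<bar>\<integral>x. \<rho> x * partial e2 (\<eta> n) x \<partial>lborel\<bar>"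
  shows "\<not> W11_loc \<rho>"
proof
  assume W11: "W11_loc \<rho>"
  \<comment> \<open>Equal to 1 on the closed square, so localising leaves the pairings
    unchanged.\<close>
  define \<zeta> where "\<zeta> = (\<lambda>x::real^2. plateau (x $ 1) * plateau (x $ 2))"
  have "Ck k (\<lambda>x::real^2. plateau (0 + 1 * (x \<bullet> e1)) * plateau (0 + 1 * (x \<bullet> e2)))" for k
    by (intro Ck_mult Ck_real_comp_inner Ck_plateau)
  then have "Ck k \<zeta>" for k by (simp add: \<zeta>_def inner_axis)
  moreover have "norm x \<le> 4" if "\<zeta> x \<noteq> 0" for x
    using that plateau_eq_0[of "x $ 1"] plateau_eq_0[of "x $ 2"] norm_le_l1_cart[of x]
    by (force simp: \<zeta>_def sum_2)
  then have "compact_support \<zeta>"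
    unfolding compact_support_iff_bounded bounded_iff by blast
  ultimately have \<zeta>: "test_function \<zeta>" by (simp add: test_function_def)
  obtain g where g: "integrable lebesgue g" "weak_partial e2 (\<lambda>x. \<zeta> x * \<rho> x) g"
    using W11 \<zeta> e2_Basis unfolding W11_loc_def by blast
  have "\<bar>\<integral>x. \<rho> x * partial e2 (\<eta> n) x \<partial>lborel\<bar> \<le> (\<integral>x. \<bar>g x\<bar> \<partial>lebesgue)" for n
  proof -
    have P: "test_function (partial e2 (\<eta> n))"
      using \<eta>(1) by (intro test_function_partial e2_Basis)
    have [measurable]: "\<rho> \<in> borel_measurable borel" "partial e2 (\<eta> n) \<in> borel_measurable borel"
      using \<rho> test_function_continuous[OF P] by (auto intro: borel_measurable_continuous_onI)
    have eq: "\<zeta> x * \<rho> x * partial e2 (\<eta> n) x = \<rho> x * partial e2 (\<eta> n) x" for x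
    \<comment> \<open>Boundary points of the square fall under the case where \<open>\<zeta>\<close>
      is 1; off the closed square \<open>\<eta> n\<close> vanishes on an open set.\<close>
    proof (cases "\<bar>x $ 1\<bar> \<le> 1 \<and> \<bar>x $ 2\<bar> \<le> 1")
      case False
      have "open {x::real^2. 1 < \<bar>x $ 1\<bar>}" "open {x::real^2. 1 < \<bar>x $ 2\<bar>}"
        by (intro open_Collect_less continuous_intros)+
      then have "open {x::real^2. 1 < \<bar>x $ 1\<bar> \<or> 1 < \<bar>x $ 2\<bar>}"
        by (rule open_Collect_disj)
      then have "partial e2 (\<eta> n) x = 0"
        by (rule partial_eq_0_if_zero_on_open) (use False \<eta>(3) in \<open>auto simp: square_def\<close>)
      then show ?thesis by simp
    qed (simp add: \<zeta>_def plateau_eq_1)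
    have "(\<integral>x. \<rho> x * partial e2 (\<eta> n) x \<partial>lborel) = (\<integral>x. \<zeta> x * \<rho> x * partial e2 (\<eta> n) x \<partial>lebesgue)"
      unfolding eq by (subst integral_completion) auto
    also have "\<dots> = - (\<integral>x. g x * \<eta> n x \<partial>lebesgue)"
      using g(2) \<eta>(1) unfolding weak_partial_def by blast
    finally have "\<bar>\<integral>x. \<rho> x * partial e2 (\<eta> n) x \<partial>lborel\<bar> = \<bar>\<integral>x. g x * \<eta> n x \<partial>lebesgue\<bar>" by simp
    also have "\<dots> \<le> (\<integral>x. \<bar>g x * \<eta> n x\<bar> \<partial>lebesgue)" by (rule integral_abs_bound)
    also have "\<dots> \<le> (\<integral>x. \<bar>g x\<bar> \<partial>lebesgue)"
    proof (rule integral_mono')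
      show "integrable lebesgue (\<lambda>x. \<bar>g x\<bar>)" using g(1) by (rule integrable_abs)
      show "\<bar>g x * \<eta> n x\<bar> \<le> \<bar>g x\<bar>" for x
        using \<eta>(2)[of n x] by (simp add: abs_mult mult_left_le)
    qed simp
    finally show ?thesis .
  qed
  then show False using pairing not_less by blast
qed

theorem theorem3p2:
  "\<exists>(v :: real^2 \<Rightarrow> real^2) (\<rho> :: real^2 \<Rightarrow> real).
     v \<in> borel_measurable borel \<and>
     compact_support v \<and>
     integrable lborel (\<lambda>x. norm (v x)) \<and>
     integrable gauss_measure2 (\<lambda>x. norm (v x)) \<and>
     continuous_on UNIV \<rho> \<and>
     probability_density \<rho> \<and>
     (\<exists>a r c. 0 < r \<and> 0 < c \<and> (\<forall>x. x \<notin> ball a r \<longrightarrow> \<rho> x = c * gauss_density2 x)) \<and>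
     integrable (density lborel (\<lambda>x. ennreal (\<rho> x))) (\<lambda>x. norm x) \<and>
     integrable (density lborel (\<lambda>x. ennreal (\<rho> x))) (\<lambda>x. norm (v x)) \<and>
     stationary_FPK (\<lambda>x. - x + v x) (density lborel (\<lambda>x. ennreal (\<rho> x))) \<and>
     \<not> W11_loc \<rho>"
proof -
  \<comment> \<open>The value of the Gaussian at squared norm 2, hence a lower bound for it on the
    square; with \<open>|W| \<le> m / 2\<close>, half of it survives in
    \<open>\<rho>0\<close>.\<close>
  define m where "m = inverse (2 * pi) * exp (- 1)"
  have m: "0 < m" by (simp add: m_def)
  have sq_norm: "(norm x)\<^sup>2 \<le> 2" if "x \<in> square" for x
  proof -
    have "(x $ 1)\<^sup>2 \<le> 1" "(x $ 2)\<^sup>2 \<le> 1"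
      using that by (auto simp: square_def abs_square_le_1)
    then show ?thesis by (simp add: norm_square_real_2)
  qed
  then have sq_gauss: "m \<le> gauss_density2 x" if "x \<in> square" for x
    using that by (auto simp: m_def gauss_density2_def)
  obtain W F :: "real^2 \<Rightarrow> real" and \<eta> :: "nat \<Rightarrow> real^2 \<Rightarrow> real" where
    sol: "weak_sol W F" and out: "\<And>x. x \<notin> square \<Longrightarrow> W x = 0" "\<And>x. x \<notin> square \<Longrightarrow> F x = 0"
    and W_le: "\<And>x. \<bar>W x\<bar> \<le> m / 2"
    and \<eta>: "\<And>n. test_function (\<eta> n)" "\<And>n x. \<bar>\<eta> n x\<bar> \<le> 1" "\<And>n x. x \<notin> square \<Longrightarrow> \<eta> n x = 0"
    and pairing: "\<And>n. real n \<le> (\<integral>x. W x * partial e2 (\<eta> n) x \<partial>lborel)"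
    using ex_singular_weak_sol[of "m / 2"] m by auto blast
  have W_cont: "continuous_on UNIV W" and F_int: "integrable lborel F"
    and weak: "\<And>\<zeta>. test_function \<zeta> \<Longrightarrow> (\<integral>x. W x * laplacian \<zeta> x + F x * partial e1 \<zeta> x \<partial>lborel) = 0"
    using sol by (auto simp: weak_sol_def)
  have bdd_square: "bounded square"
    unfolding bounded_iff using sq_norm by (metis abs_le_square_iff abs_norm_cancel real_sqrt_pow2 real_sqrt_abs real_sqrt_le_mono)
  have W_int: "integrable lborel W" and nW_int: "integrable lborel (\<lambda>x. norm x * W x)"
    by (intro integrable_continuous_bounded_support continuous_intros W_cont bounded_subset[OF bdd_square];
        use out in auto)+
  define \<rho>0 where "\<rho>0 = (\<lambda>x. gauss_density2 x + W x)"
  have \<rho>0_sq: "m / 2 \<le> \<rho>0 x" if "x \<in> square" for x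
    using sq_gauss[OF that] W_le[of x] by (auto simp: \<rho>0_def abs_le_iff)
  have \<rho>0_pos: "0 < \<rho>0 x" for x
    using \<rho>0_sq[of x] m gauss_density2_pos[of x] out(1)[of x] by (cases "x \<in> square") (auto simp: \<rho>0_def)
  have \<rho>0_cont: "continuous_on UNIV \<rho>0"
    unfolding \<rho>0_def by (intro continuous_intros continuous_gauss_density2 W_cont)
  have \<rho>0_int: "integrable lborel \<rho>0" and n\<rho>0_int: "integrable lborel (\<lambda>x. norm x * \<rho>0 x)"
    unfolding \<rho>0_def using W_int nW_int integrable_gauss_density2 by (auto simp: distrib_left)
  define c where "c = 1 / integral\<^sup>L lborel \<rho>0"
  have c: "0 < c"
    using integral_continuous_pos[OF \<rho>0_cont \<rho>0_int less_imp_le[OF \<rho>0_pos] \<rho>0_pos[of 0]] by (simp add: c_def)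
  define \<rho> where "\<rho> = (\<lambda>x. c * \<rho>0 x)"
  define v where "v = (\<lambda>x. (1 / \<rho>0 x) *\<^sub>R (F x *\<^sub>R e1 + W x *\<^sub>R x))"
  have [measurable]: "W \<in> borel_measurable borel" "F \<in> borel_measurable borel" "\<rho>0 \<in> borel_measurable borel"
    using W_cont F_int \<rho>0_cont by (auto intro: borel_measurable_continuous_onI)
  have \<rho>_meas [measurable]: "\<rho> \<in> borel_measurable borel"
    unfolding \<rho>_def by measurable
  have \<rho>_nonneg: "0 \<le> \<rho> x" for x
    using c \<rho>0_pos[of x] by (simp add: \<rho>_def)
  have \<rho>_le: "\<rho> x \<le> c * (1 + m / 2)" for x
    unfolding \<rho>_def \<rho>0_def using c W_le[of x] gauss_density2_le_1[of x]
    by (intro mult_left_mono add_mono) (auto simp: abs_le_iff)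
  have v_meas [measurable]: "v \<in> borel_measurable borel"
    unfolding v_def by measurable
  have v_out: "v x = 0" if "x \<notin> square" for x
    using out that by (simp add: v_def)
  then have v_supp: "compact_support v"
    unfolding compact_support_iff_bounded by (intro bounded_subset[OF bdd_square]) auto
  have v_int: "integrable lborel (\<lambda>x. norm (v x))"
  proof (rule Bochner_Integration.integrable_bound)
    \<comment> \<open>On the square the denominator of \<open>v\<close> is at least
      \<open>m / 2\<close>; outside, \<open>v\<close> is zero.\<close>
    show "integrable lborel (\<lambda>x. 2 / m * (\<bar>F x\<bar> + \<bar>norm x * W x\<bar>))"
      using F_int nW_int by auto
    have "norm (v x) \<le> 2 / m * (\<bar>F x\<bar> + \<bar>norm x * W x\<bar>)" for x
    proof (cases "x \<in> square")
      case True
      have "norm (F x *\<^sub>R e1 + W x *\<^sub>R x) \<le> \<bar>F x\<bar> + \<bar>norm x * W x\<bar>"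
        using norm_triangle_ineq[of "F x *\<^sub>R e1" "W x *\<^sub>R x"] by (simp add: abs_mult mult.commute)
      moreover have "1 / \<rho>0 x \<le> 2 / m"
        using \<rho>0_sq[OF True] \<rho>0_pos[of x] m by (simp add: field_simps)
      ultimately have "1 / \<rho>0 x * norm (F x *\<^sub>R e1 + W x *\<^sub>R x) \<le> 2 / m * (\<bar>F x\<bar> + \<bar>norm x * W x\<bar>)"
        using m by (intro mult_mono) auto
      then show ?thesis using \<rho>0_pos[of x] by (simp add: v_def)
    qed (use v_out m in simp)
    then show "AE x in lborel. norm (norm (v x)) \<le> norm (2 / m * (\<bar>F x\<bar> + \<bar>norm x * W x\<bar>))"
      using m by (intro AE_I2) (simp add: abs_mult)
  qed measurable
  let ?\<mu> = "density lborel (\<lambda>x. ennreal (\<rho> x))"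
  have n_int: "integrable ?\<mu> norm"
    using n\<rho>0_int \<rho>_nonneg by (subst integrable_density) (auto simp: \<rho>_def mult.assoc mult.commute[of "\<rho>0 _"])
  have v_int\<mu>: "integrable ?\<mu> (\<lambda>x. norm (v x))"
    by (rule integrable_density_bounded[OF \<rho>_meas \<rho>_nonneg \<rho>_le v_int])
  have prob: "probability_density \<rho>"
    unfolding probability_density_def has_bochner_integral_iff
    using \<rho>_nonneg \<rho>0_int c by (simp add: \<rho>_def) (simp add: c_def)
  have fpk: "stationary_FPK (\<lambda>x. - x + v x) ?\<mu>"
    unfolding stationary_FPK_def
  proof (intro conjI allI impI)
    have "emeasure ?\<mu> (space ?\<mu>) = (\<integral>\<^sup>+x. ennreal (\<rho> x) \<partial>lborel)"
      by (subst emeasure_density) auto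
    also have "\<dots> < \<infinity>"
      using prob \<rho>_nonneg by (subst nn_integral_eq_integral) (auto simp: probability_density_def has_bochner_integral_iff)
    finally show "finite_measure ?\<mu>" by (intro finite_measureI) auto
    show "(\<lambda>x. - x + v x) \<in> borel_measurable borel" by measurable
    have b_int: "integrable ?\<mu> (\<lambda>x. norm (- x + v x))"
    proof (rule Bochner_Integration.integrable_bound)
      show "integrable ?\<mu> (\<lambda>x. norm x + norm (v x))"
        using n_int v_int\<mu> by auto
      show "AE x in ?\<mu>. norm (norm (- x + v x)) \<le> norm (norm x + norm (v x))"
        using norm_triangle_ineq[of "- _" "v _"] by (intro AE_I2) (auto simp: abs_of_nonneg)
    qed measurable
    then show "set_integrable ?\<mu> K (\<lambda>x. norm (- x + v x))" if "compact K" for K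
      unfolding set_integrable_def
      using that by (intro integrable_mult_indicator) (auto intro: borel_compact)
    fix \<phi> :: "real^2 \<Rightarrow> real"
    assume \<phi>: "test_function \<phi>"
    have P: "test_function (partial e1 \<phi>)" "test_function (partial e2 \<phi>)" "test_function (laplacian \<phi>)"
      using \<phi> by (auto intro: test_function_partial test_function_laplacian e1_Basis e2_Basis)
    have [measurable]: "partial e1 \<phi> \<in> borel_measurable borel" "partial e2 \<phi> \<in> borel_measurable borel"
      "laplacian \<phi> \<in> borel_measurable borel"
      using P by (auto intro!: borel_measurable_continuous_onI test_function_continuous)
    have v_mult: "\<rho> x * (v x \<bullet> y) = c * (F x * (e1 \<bullet> y) + W x * (x \<bullet> y))" for x y
      using \<rho>0_pos[of x] by (simp add: \<rho>_def v_def inner_add_left)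
    have e1_grad: "e1 \<bullet> grad \<phi> x = partial e1 \<phi> x" for x
      by (simp add: inner_grad_real_2 axis_def)
    \<comment> \<open>What remains is \<open>c\<close> times the Gaussian generator plus the
      integrand of the weak equation with \<open>\<phi>\<close> as test function; each of the two
      integrates to 0.\<close>
    have drift: "\<rho> x * drift_operator (\<lambda>x. - x + v x) \<phi> x =
        c * (gauss_density2 x * (laplacian \<phi> x - x \<bullet> grad \<phi> x) + (W x * laplacian \<phi> x + F x * partial e1 \<phi> x))" for x
      unfolding drift_operator_def inner_add_left distrib_left v_mult e1_grad
      by (simp add: \<rho>_def \<rho>0_def algebra_simps)
    have drift_meas: "drift_operator (\<lambda>x. - x + v x) \<phi> \<in> borel_measurable borel"
      unfolding drift_operator_def[abs_def] inner_grad_real_2 cart_eq_inner_axis by measurable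
    have "has_bochner_integral lborel (\<lambda>x. W x * laplacian \<phi> x + F x * partial e1 \<phi> x) 0"
      using weak[OF \<phi>] integrable_weak_sol[OF sol \<phi>] by (simp add: has_bochner_integral_iff)
    then have "has_bochner_integral lborel (\<lambda>x. \<rho> x * drift_operator (\<lambda>x. - x + v x) \<phi> x) (c * (0 + 0))"
      unfolding drift by (intro has_bochner_integral_mult_right has_bochner_integral_add
          integral_gauss_density2_generator \<phi>)
    then show "(\<integral>x. drift_operator (\<lambda>x. - x + v x) \<phi> x \<partial>?\<mu>) = 0"
      using \<rho>_nonneg drift_meas
      by (subst integral_density) (auto simp: has_bochner_integral_iff simp del: uminus_add_conv_diff)
  qed simp
  have not_W11: "\<not> W11_loc \<rho>"
  proof (rule not_W11_loc_if_unbounded_pairing[OF \<rho>_meas \<eta>])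
    fix A :: real
    define G where "G = (\<integral>x. norm (x::real^2) * gauss_density2 x \<partial>lborel)"
    \<comment> \<open>The Gaussian part of the pairing is at least \<open>- G\<close>, so
      \<open>n\<close> must exceed \<open>A / c\<close> by \<open>G\<close>.\<close>
    obtain n :: nat where n: "A / c + G < n" using reals_Archimedean2 by blast
    have P: "test_function (partial e2 (\<eta> n))"
      using \<eta>(1) by (intro test_function_partial e2_Basis)
    have "(\<integral>x. \<rho> x * partial e2 (\<eta> n) x \<partial>lborel) =
        (\<integral>x. c * (gauss_density2 x * partial e2 (\<eta> n) x + W x * partial e2 (\<eta> n) x) \<partial>lborel)"
      by (simp add: \<rho>_def \<rho>0_def algebra_simps)
    also have "\<dots> = c * ((\<integral>x. gauss_density2 x * partial e2 (\<eta> n) x \<partial>lborel) +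
        (\<integral>x. W x * partial e2 (\<eta> n) x \<partial>lborel))"
      using integrable_continuous_times_test[OF continuous_gauss_density2 P]
        integrable_continuous_times_test[OF W_cont P] by simp
    also have "\<dots> \<ge> c * (- G + n)"
      using pairing[of n] integral_gauss_density2_partial_le[OF \<eta>(1,2), of n] c
      by (intro mult_left_mono add_mono) (auto simp: G_def abs_le_iff)
    finally have "c * (- G + n) \<le> \<bar>\<integral>x. \<rho> x * partial e2 (\<eta> n) x \<partial>lborel\<bar>" by linarith
    moreover have "A < c * (- G + n)" using n c by (simp add: field_simps)
    ultimately show "\<exists>n. A < \<bar>\<integral>x. \<rho> x * partial e2 (\<eta> n) x \<partial>lborel\<bar>" by (meson less_le_trans)
  qed
  have gauss_v: "integrable gauss_measure2 (\<lambda>x. norm (v x))"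
    unfolding gauss_measure2_def
    by (rule integrable_density_bounded[OF borel_measurable_continuous_onI[OF continuous_gauss_density2]
          less_imp_le[OF gauss_density2_pos] gauss_density2_le_1 v_int])
  \<comment> \<open>The square lies in the closed ball of radius \<open>sqrt 2\<close>, so radius 2
    is enough.\<close>
  have "\<rho> x = c * gauss_density2 x" if "x \<notin> ball 0 2" for x
  proof -
    have "x \<notin> square"
    proof
      assume "x \<in> square"
      then have "(norm x)\<^sup>2 \<le> 2" by (rule sq_norm)
      moreover have "2\<^sup>2 \<le> (norm x)\<^sup>2" using that by (intro power_mono) auto
      ultimately show False by simp
    qed
    then show ?thesis by (simp add: \<rho>_def \<rho>0_def out)
  qed
  then have "\<exists>a r c. 0 < r \<and> 0 < c \<and> (\<forall>x. x \<notin> ball a r \<longrightarrow> \<rho> x = c * gauss_density2 x)"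
    using c by (intro exI[of _ 0] exI[of _ 2] exI[of _ c]) auto
  moreover have "continuous_on UNIV \<rho>"
    unfolding \<rho>_def by (intro continuous_intros \<rho>0_cont)
  ultimately show ?thesis
    using v_meas v_supp v_int gauss_v prob n_int v_int\<mu> fpk not_W11 by blast
qed

end
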